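(* Let $\nabla$ be a torsion-free connection with symmetric projective Schouten tensor on an $n$-dimensional manifold $M$, and let $(g^{ab},\mu^a,\rho)$, with $g^{ab}$ a symmetric tensor, $\mu^a$ a vector field and $\rho$ a function on $M$, satisfy the system $$\begin{aligned}&\mathrm Dg^{bc}=\mu^c\theta^b+\mu^b\theta^c,\\&\mathrm D\mu^b=\rho\,\theta^b-\omega_cg^{bc}-\tfrac1nW^b_{~cda}g^{cd}\theta^a,\\&\mathrm D\rho=-2\omega_b\mu^b+\tfrac2nY_{abc}g^{bc}\theta^a.\end{aligned}$$ Then the integrability condition $\mathrm D^2\mu^b=\Omega^b_{~a}\mu^a$ is equivalent to $$S_{[ae]}{}^{b}{}_{cd}\,g^{cd}=\Big(\tfrac{n+4}2W^b_{~cae}+W^b_{~[ae]c}\Big)\mu^c,$$ where $$S_{[ae]}{}^{b}{}_{cd}=\tfrac{n-2}2Y_{ea(c}\delta^b_{~d)}+\nabla_{(c}W^b_{~d)ea}+W^b_{~(cd)[e;a]}.$$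
   Context: $n\ge2$; $(\theta^a)$ is a local coframe dual to a frame $(X_a)$; the connection 1-forms of $\nabla$ are $\Gamma^a_{~b}=\Gamma^a_{~bc}\theta^c$ with $\nabla_{X_a}X_b=\Gamma^c_{~ba}X_c$. $\mathrm D$ is the covariant exterior differential on tensor-valued forms (on tensor-valued functions $\mathrm DK=\theta^c\nabla_cK$). Curvature: $\Omega^a_{~b}=d\Gamma^a_{~b}+\Gamma^a_{~c}\wedge\Gamma^c_{~b}=\frac12R^a_{~bcd}\theta^c\wedge\theta^d$, $R_{ab}=R^c_{~acb}$. Projective Schouten tensor: $\mathsf P_{ab}=\frac1{n-1}R_{(ab)}-\frac1{n+1}R_{[ab]}$, assumed symmetric here, and $\omega_b=\theta^a\mathsf P_{ab}$. Projective Weyl tensor: $W^a_{~bcd}=R^a_{~bcd}-\delta^a_{~c}\mathsf P_{db}+\delta^a_{~d}\mathsf P_{cb}+2\delta^a_{~b}\mathsf P_{[cd]}$. Projective Cotton tensor: $Y_{bca}=2\nabla_{[b}\mathsf P_{c]a}$. Round (square) brackets denote symmetrization (antisymmetrization) over the two enclosed indices with factor $\frac12$. The semicolon denotes covariant derivative, so $W^b_{~(cd)[e;a]}=\frac12\big(\nabla_aW^b_{~(cd)e}-\nabla_eW^b_{~(cd)a}\big)$. *)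

theory Defs
  imports "HOL-Analysis.Analysis"
begin

text \<open>
  Smoothness on an open subset of a Euclidean space: all iterated directional derivatives
  exist and are continuous.
\<close>

primrec Ck_on :: "nat \<Rightarrow> 'a::euclidean_space set \<Rightarrow> ('a \<Rightarrow> 'b::real_normed_vector) \<Rightarrow> bool" where
  "Ck_on 0 S f \<longleftrightarrow> continuous_on S f"
| "Ck_on (Suc k) S f \<longleftrightarrow> (\<forall>x\<in>S. f differentiable (at x)) \<and>
     (\<forall>v. Ck_on k S (\<lambda>x. frechet_derivative f (at x) v))"

definition smooth_on :: "'a::euclidean_space set \<Rightarrow> ('a \<Rightarrow> 'b::real_normed_vector) \<Rightarrow> bool" where
  "smooth_on S f \<longleftrightarrow> (\<forall>k. Ck_on k S f)"

text \<open>
  The manifold \<open>M\<close> is a Hausdorff, second countable space, given as a whole type \<open>'m\<close>, together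
  with an atlas of charts \<open>(U, \<phi>)\<close> with values in \<open>real ^ 'n\<close>. Its dimension is \<open>CARD('n)\<close>.
\<close>

type_synonym ('m, 'n) atlas = "('m set \<times> ('m \<Rightarrow> real ^ 'n)) set"

definition smooth_atlas ::
    "('m::{t2_space, second_countable_topology}, 'n::finite) atlas \<Rightarrow> bool" where
  "smooth_atlas A \<longleftrightarrow>
     (\<forall>(U, \<phi>) \<in> A. open U \<and> open (\<phi> ` U) \<and> homeomorphism U (\<phi> ` U) \<phi> (inv_into U \<phi>)) \<and>
     (\<Union>(U, \<phi>) \<in> A. U) = UNIV \<and>
     (\<forall>(U, \<phi>) \<in> A. \<forall>(V, \<psi>) \<in> A. smooth_on (\<phi> ` (U \<inter> V)) (\<psi> \<circ> inv_into U \<phi>))"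

definition smooth_fun ::
    "('m::topological_space, 'n::finite) atlas \<Rightarrow> 'm set \<Rightarrow> ('m \<Rightarrow> real) \<Rightarrow> bool" where
  "smooth_fun A W f \<longleftrightarrow> (\<forall>(U, \<phi>) \<in> A. smooth_on (\<phi> ` (U \<inter> W)) (f \<circ> inv_into U \<phi>))"

definition smooth_near ::
    "('m::topological_space, 'n::finite) atlas \<Rightarrow> 'm \<Rightarrow> ('m \<Rightarrow> real) \<Rightarrow> bool" where
  "smooth_near A p f \<longleftrightarrow> (\<exists>W. open W \<and> p \<in> W \<and> smooth_fun A W f)"

text \<open>
  Tangent vectors at \<open>p\<close> are the derivations of the algebra of germs of smooth functions at \<open>p\<close>.
  A germ is represented by any total function that is smooth near \<open>p\<close>. On functions that are not
  smooth near \<open>p\<close> the value is fixed to \<open>0\<close>, so that equality of derivations is equality of functions.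
\<close>

type_synonym 'm tvec = "('m \<Rightarrow> real) \<Rightarrow> real"

definition tangent_space ::
    "('m::topological_space, 'n::finite) atlas \<Rightarrow> 'm \<Rightarrow> 'm tvec set" where
  "tangent_space A p = {v.
     (\<forall>f h. smooth_near A p f \<longrightarrow> smooth_near A p h \<longrightarrow>
        v (\<lambda>q. f q + h q) = v f + v h \<and>
        v (\<lambda>q. f q * h q) = f p * v h + h p * v f) \<and>
     (\<forall>c f. smooth_near A p f \<longrightarrow> v (\<lambda>q. c * f q) = c * v f) \<and>
     (\<forall>W f h. open W \<longrightarrow> p \<in> W \<longrightarrow> (\<forall>q\<in>W. f q = h q) \<longrightarrow> v f = v h) \<and>
     (\<forall>f. \<not> smooth_near A p f \<longrightarrow> v f = 0)}"

definition cotangent_space ::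
    "('m::topological_space, 'n::finite) atlas \<Rightarrow> 'm \<Rightarrow> ('m tvec \<Rightarrow> real) set" where
  "cotangent_space A p = {\<alpha>.
     (\<forall>v\<in>tangent_space A p. \<forall>w\<in>tangent_space A p. \<alpha> (\<lambda>f. v f + w f) = \<alpha> v + \<alpha> w) \<and>
     (\<forall>c. \<forall>v\<in>tangent_space A p. \<alpha> (\<lambda>f. c * v f) = c * \<alpha> v) \<and>
     (\<forall>v. v \<notin> tangent_space A p \<longrightarrow> \<alpha> v = 0)}"

text \<open>
  Fields on an open set \<open>W\<close> are total functions whose values off \<open>W\<close> are irrelevant.
\<close>

type_synonym 'm vfield = "'m \<Rightarrow> 'm tvec"
type_synonym 'm form1 = "'m \<Rightarrow> 'm tvec \<Rightarrow> real"
type_synonym 'm form2 = "'m vfield \<Rightarrow> 'm vfield \<Rightarrow> 'm \<Rightarrow> real"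
type_synonym 'm bivector = "'m \<Rightarrow> ('m tvec \<Rightarrow> real) \<Rightarrow> ('m tvec \<Rightarrow> real) \<Rightarrow> real"

definition vector_field ::
    "('m::topological_space, 'n::finite) atlas \<Rightarrow> 'm set \<Rightarrow> 'm vfield \<Rightarrow> bool" where
  "vector_field A W X \<longleftrightarrow> (\<forall>p\<in>W. X p \<in> tangent_space A p) \<and>
     (\<forall>V f. open V \<longrightarrow> V \<subseteq> W \<longrightarrow> smooth_fun A V f \<longrightarrow> smooth_fun A V (\<lambda>p. X p f))"

definition one_form ::
    "('m::topological_space, 'n::finite) atlas \<Rightarrow> 'm set \<Rightarrow> 'm form1 \<Rightarrow> bool" where
  "one_form A W \<alpha> \<longleftrightarrow> (\<forall>p\<in>W. \<alpha> p \<in> cotangent_space A p) \<and>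
     (\<forall>V X. open V \<longrightarrow> V \<subseteq> W \<longrightarrow> vector_field A V X \<longrightarrow> smooth_fun A V (\<lambda>p. \<alpha> p (X p)))"

text \<open>Symmetric tensor fields of type (2,0) on \<open>W\<close>, as bilinear forms on the cotangent spaces.\<close>

definition symmetric_bivector ::
    "('m::topological_space, 'n::finite) atlas \<Rightarrow> 'm set \<Rightarrow> 'm bivector \<Rightarrow> bool" where
  "symmetric_bivector A W g \<longleftrightarrow>
     (\<forall>p\<in>W. \<forall>\<alpha>\<in>cotangent_space A p. \<forall>\<beta>\<in>cotangent_space A p.
        g p \<alpha> \<beta> = g p \<beta> \<alpha> \<and>
        (\<forall>c. g p (\<lambda>v. c * \<alpha> v) \<beta> = c * g p \<alpha> \<beta>) \<and>
        (\<forall>\<alpha>'\<in>cotangent_space A p. g p (\<lambda>v. \<alpha> v + \<alpha>' v) \<beta> = g p \<alpha> \<beta> + g p \<alpha>' \<beta>)) \<and>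
     (\<forall>V \<alpha> \<beta>. open V \<longrightarrow> V \<subseteq> W \<longrightarrow> one_form A V \<alpha> \<longrightarrow> one_form A V \<beta> \<longrightarrow>
        smooth_fun A V (\<lambda>p. g p (\<alpha> p) (\<beta> p)))"

definition lie_bracket ::
    "('m::topological_space, 'n::finite) atlas \<Rightarrow> 'm vfield \<Rightarrow> 'm vfield \<Rightarrow> 'm vfield" where
  "lie_bracket A X Y = (\<lambda>p f. if smooth_near A p f
     then X p (\<lambda>q. Y q f) - Y p (\<lambda>q. X q f) else 0)"

definition vf_add :: "'m vfield \<Rightarrow> 'm vfield \<Rightarrow> 'm vfield" where
  "vf_add X Y = (\<lambda>p f. X p f + Y p f)"

definition vf_scale :: "('m \<Rightarrow> real) \<Rightarrow> 'm vfield \<Rightarrow> 'm vfield" where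
  "vf_scale h X = (\<lambda>p f. h p * X p f)"

text \<open>
  \<open>nabla X Y\<close> is the covariant derivative of \<open>Y\<close> along \<open>X\<close>. The connection acts on vector fields on
  arbitrary open sets, compatibly with restriction (last clause), so that it can be applied to
  local frames.
\<close>

definition affine_connection ::
    "('m::topological_space, 'n::finite) atlas \<Rightarrow> ('m vfield \<Rightarrow> 'm vfield \<Rightarrow> 'm vfield) \<Rightarrow> bool" where
  "affine_connection A nabla \<longleftrightarrow>
     (\<forall>W X Y. open W \<longrightarrow> vector_field A W X \<longrightarrow> vector_field A W Y \<longrightarrow>
        vector_field A W (nabla X Y) \<and>
        (\<forall>Z. vector_field A W Z \<longrightarrow> (\<forall>p\<in>W.
           nabla (vf_add X Z) Y p = vf_add (nabla X Y) (nabla Z Y) p \<and>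
           nabla X (vf_add Y Z) p = vf_add (nabla X Y) (nabla X Z) p)) \<and>
        (\<forall>h. smooth_fun A W h \<longrightarrow> (\<forall>p\<in>W.
           nabla (vf_scale h X) Y p = vf_scale h (nabla X Y) p \<and>
           nabla X (vf_scale h Y) p =
             vf_add (vf_scale (\<lambda>q. X q h) Y) (vf_scale h (nabla X Y)) p)) \<and>
        (\<forall>X' Y'. (\<forall>p\<in>W. X' p = X p \<and> Y' p = Y p) \<longrightarrow> (\<forall>p\<in>W. nabla X' Y' p = nabla X Y p)))"

definition torsion_free ::
    "('m::topological_space, 'n::finite) atlas \<Rightarrow> ('m vfield \<Rightarrow> 'm vfield \<Rightarrow> 'm vfield) \<Rightarrow> bool" where
  "torsion_free A nabla \<longleftrightarrow>
     (\<forall>W X Y. open W \<longrightarrow> vector_field A W X \<longrightarrow> vector_field A W Y \<longrightarrow>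
        (\<forall>p\<in>W. \<forall>f. nabla X Y p f - nabla Y X p f = lie_bracket A X Y p f))"

definition local_frame ::
    "('m::topological_space, 'n::finite) atlas \<Rightarrow> 'm set \<Rightarrow> ('n \<Rightarrow> 'm vfield) \<Rightarrow> bool" where
  "local_frame A U X \<longleftrightarrow> open U \<and> (\<forall>a. vector_field A U (X a)) \<and>
     (\<forall>p\<in>U. \<forall>v\<in>tangent_space A p. \<exists>!c. v = (\<lambda>f. \<Sum>a\<in>UNIV. c a * X a p f))"

definition kdelta :: "'n \<Rightarrow> 'n \<Rightarrow> real" where
  "kdelta a b = (if a = b then 1 else 0)"

definition dual_coframe ::
    "('m::topological_space, 'n::finite) atlas \<Rightarrow> 'm set \<Rightarrow> ('n \<Rightarrow> 'm vfield) \<Rightarrow> ('n \<Rightarrow> 'm form1) \<Rightarrow> bool"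
  where
  "dual_coframe A U X \<theta> \<longleftrightarrow> (\<forall>a. one_form A U (\<theta> a)) \<and>
     (\<forall>p\<in>U. \<forall>a b. \<theta> a p (X b p) = kdelta a b)"

text \<open>
  The connection 1-forms, whose coefficient with respect to \<open>\<theta> c\<close> is the \<open>a\<close>-component of the
  covariant derivative of \<open>X b\<close> along \<open>X c\<close>; the direction of differentiation is the last index.
\<close>

definition connection_form ::
    "('m vfield \<Rightarrow> 'm vfield \<Rightarrow> 'm vfield) \<Rightarrow> ('n::finite \<Rightarrow> 'm vfield) \<Rightarrow> ('n \<Rightarrow> 'm form1)
     \<Rightarrow> 'n \<Rightarrow> 'n \<Rightarrow> 'm form1" where
  "connection_form nabla X \<theta> a b =
     (\<lambda>p v. \<Sum>c\<in>UNIV. \<theta> a p (nabla (X c) (X b) p) * \<theta> c p v)"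

text \<open>
  The normalization of the wedge product and of the exterior derivative is the one in which
  \<open>\<theta> c \<and> \<theta> d\<close> takes the value \<open>1\<close> on \<open>(X c, X d)\<close> for \<open>c \<noteq> d\<close>.
\<close>

definition wedge :: "'m form1 \<Rightarrow> 'm form1 \<Rightarrow> 'm form2" where
  "wedge \<alpha> \<beta> = (\<lambda>Y Z p. \<alpha> p (Y p) * \<beta> p (Z p) - \<alpha> p (Z p) * \<beta> p (Y p))"

definition ext_deriv ::
    "('m::topological_space, 'n::finite) atlas \<Rightarrow> 'm form1 \<Rightarrow> 'm form2" where
  "ext_deriv A \<alpha> = (\<lambda>Y Z p. Y p (\<lambda>q. \<alpha> q (Z q)) - Z p (\<lambda>q. \<alpha> q (Y q))
     - \<alpha> p (lie_bracket A Y Z p))"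

text \<open>
  Tensor-valued functions and 1-forms are given by their components in the frame;
  \<open>K us ls\<close> is the component of \<open>K\<close> with list \<open>us\<close> of upper and list \<open>ls\<close> of lower indices.
  The two operators below are the covariant exterior differential in degrees 0 and 1, for the
  connection 1-forms \<open>\<Gamma>\<close>. In degree 0 the first summand \<open>v (K us ls)\<close> is the differential of the
  component function evaluated on \<open>v\<close>.
\<close>

definition cov_diff0 ::
    "('n::finite \<Rightarrow> 'n \<Rightarrow> 'm form1) \<Rightarrow> ('n list \<Rightarrow> 'n list \<Rightarrow> 'm \<Rightarrow> real)
     \<Rightarrow> 'n list \<Rightarrow> 'n list \<Rightarrow> 'm form1" where
  "cov_diff0 \<Gamma> K us ls = (\<lambda>p v. v (K us ls)
     + (\<Sum>i<length us. \<Sum>a\<in>UNIV. \<Gamma> (us ! i) a p v * K (us[i := a]) ls p)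
     - (\<Sum>i<length ls. \<Sum>a\<in>UNIV. \<Gamma> a (ls ! i) p v * K us (ls[i := a]) p))"

definition cov_diff1 ::
    "('m::topological_space, 'n::finite) atlas \<Rightarrow> ('n \<Rightarrow> 'n \<Rightarrow> 'm form1)
     \<Rightarrow> ('n list \<Rightarrow> 'n list \<Rightarrow> 'm form1) \<Rightarrow> 'n list \<Rightarrow> 'n list \<Rightarrow> 'm form2" where
  "cov_diff1 A \<Gamma> K us ls = (\<lambda>Y Z p. ext_deriv A (K us ls) Y Z p
     + (\<Sum>i<length us. \<Sum>a\<in>UNIV. wedge (\<Gamma> (us ! i) a) (K (us[i := a]) ls) Y Z p)
     - (\<Sum>i<length ls. \<Sum>a\<in>UNIV. wedge (\<Gamma> a (ls ! i)) (K us (ls[i := a])) Y Z p))"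

definition sym2 :: "('n \<Rightarrow> 'n \<Rightarrow> real) \<Rightarrow> 'n \<Rightarrow> 'n \<Rightarrow> real" where
  "sym2 T a b = (T a b + T b a) / 2"

definition alt2 :: "('n \<Rightarrow> 'n \<Rightarrow> real) \<Rightarrow> 'n \<Rightarrow> 'n \<Rightarrow> real" where
  "alt2 T a b = (T a b - T b a) / 2"

definition curv_form ::
    "('m::topological_space, 'n::finite) atlas \<Rightarrow> ('n \<Rightarrow> 'n \<Rightarrow> 'm form1) \<Rightarrow> 'n \<Rightarrow> 'n \<Rightarrow> 'm form2" where
  "curv_form A \<Gamma> a b = (\<lambda>Y Z p. ext_deriv A (\<Gamma> a b) Y Z p
     + (\<Sum>c\<in>UNIV. wedge (\<Gamma> a c) (\<Gamma> c b) Y Z p))"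

text \<open>The coefficients, skew in \<open>c\<close> and \<open>d\<close>, in \<open>\<Omega> = 1/2 R \<theta> c \<and> \<theta> d\<close>.\<close>

definition riem ::
    "('m::topological_space, 'n::finite) atlas \<Rightarrow> ('n \<Rightarrow> 'm vfield) \<Rightarrow> ('n \<Rightarrow> 'n \<Rightarrow> 'm form1)
     \<Rightarrow> 'n \<Rightarrow> 'n \<Rightarrow> 'n \<Rightarrow> 'n \<Rightarrow> 'm \<Rightarrow> real" where
  "riem A X \<Gamma> a b c d p = curv_form A \<Gamma> a b (X c) (X d) p"

definition ricci ::
    "('m::topological_space, 'n::finite) atlas \<Rightarrow> ('n \<Rightarrow> 'm vfield) \<Rightarrow> ('n \<Rightarrow> 'n \<Rightarrow> 'm form1)
     \<Rightarrow> 'n \<Rightarrow> 'n \<Rightarrow> 'm \<Rightarrow> real" where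
  "ricci A X \<Gamma> a b p = (\<Sum>c\<in>UNIV. riem A X \<Gamma> c a c b p)"

definition schouten ::
    "('m::topological_space, 'n::finite) atlas \<Rightarrow> ('n \<Rightarrow> 'm vfield) \<Rightarrow> ('n \<Rightarrow> 'n \<Rightarrow> 'm form1)
     \<Rightarrow> 'n \<Rightarrow> 'n \<Rightarrow> 'm \<Rightarrow> real" where
  "schouten A X \<Gamma> a b p =
     1 / (real CARD('n) - 1) * sym2 (\<lambda>a b. ricci A X \<Gamma> a b p) a b
     - 1 / (real CARD('n) + 1) * alt2 (\<lambda>a b. ricci A X \<Gamma> a b p) a b"

definition schouten_form ::
    "('m::topological_space, 'n::finite) atlas \<Rightarrow> ('n \<Rightarrow> 'm vfield) \<Rightarrow> ('n \<Rightarrow> 'm form1)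
     \<Rightarrow> ('n \<Rightarrow> 'n \<Rightarrow> 'm form1) \<Rightarrow> 'n \<Rightarrow> 'm form1" where
  "schouten_form A X \<theta> \<Gamma> b = (\<lambda>p v. \<Sum>a\<in>UNIV. \<theta> a p v * schouten A X \<Gamma> a b p)"

definition weyl ::
    "('m::topological_space, 'n::finite) atlas \<Rightarrow> ('n \<Rightarrow> 'm vfield) \<Rightarrow> ('n \<Rightarrow> 'n \<Rightarrow> 'm form1)
     \<Rightarrow> 'n \<Rightarrow> 'n \<Rightarrow> 'n \<Rightarrow> 'n \<Rightarrow> 'm \<Rightarrow> real" where
  "weyl A X \<Gamma> a b c d p = riem A X \<Gamma> a b c d p
     - kdelta a c * schouten A X \<Gamma> d b p
     + kdelta a d * schouten A X \<Gamma> c b p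
     + 2 * kdelta a b * alt2 (\<lambda>c d. schouten A X \<Gamma> c d p) c d"

text \<open>
  Components of the covariant derivatives of the Schouten and Weyl tensors; the last index
  before the point is the direction of differentiation.
\<close>

definition schouten_deriv ::
    "('m::topological_space, 'n::finite) atlas \<Rightarrow> ('n \<Rightarrow> 'm vfield) \<Rightarrow> ('n \<Rightarrow> 'n \<Rightarrow> 'm form1)
     \<Rightarrow> 'n \<Rightarrow> 'n \<Rightarrow> 'n \<Rightarrow> 'm \<Rightarrow> real" where
  "schouten_deriv A X \<Gamma> a b e p =
     cov_diff0 \<Gamma> (\<lambda>us ls. schouten A X \<Gamma> (ls ! 0) (ls ! 1)) [] [a, b] p (X e p)"

definition weyl_deriv ::
    "('m::topological_space, 'n::finite) atlas \<Rightarrow> ('n \<Rightarrow> 'm vfield) \<Rightarrow> ('n \<Rightarrow> 'n \<Rightarrow> 'm form1)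
     \<Rightarrow> 'n \<Rightarrow> 'n \<Rightarrow> 'n \<Rightarrow> 'n \<Rightarrow> 'n \<Rightarrow> 'm \<Rightarrow> real" where
  "weyl_deriv A X \<Gamma> a b c d e p =
     cov_diff0 \<Gamma> (\<lambda>us ls. weyl A X \<Gamma> (us ! 0) (ls ! 0) (ls ! 1) (ls ! 2)) [a] [b, c, d] p (X e p)"

definition cotton ::
    "('m::topological_space, 'n::finite) atlas \<Rightarrow> ('n \<Rightarrow> 'm vfield) \<Rightarrow> ('n \<Rightarrow> 'n \<Rightarrow> 'm form1)
     \<Rightarrow> 'n \<Rightarrow> 'n \<Rightarrow> 'n \<Rightarrow> 'm \<Rightarrow> real" where
  "cotton A X \<Gamma> b c a p = 2 * alt2 (\<lambda>b c. schouten_deriv A X \<Gamma> c a b p) b c"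

text \<open>The index order is that of \<open>S\<close> read from left to right, with \<open>b\<close> the upper index.\<close>

definition S_tensor ::
    "('m::topological_space, 'n::finite) atlas \<Rightarrow> ('n \<Rightarrow> 'm vfield) \<Rightarrow> ('n \<Rightarrow> 'n \<Rightarrow> 'm form1)
     \<Rightarrow> 'n \<Rightarrow> 'n \<Rightarrow> 'n \<Rightarrow> 'n \<Rightarrow> 'n \<Rightarrow> 'm \<Rightarrow> real" where
  "S_tensor A X \<Gamma> a e b c d p =
     (real CARD('n) - 2) / 2 * sym2 (\<lambda>c d. cotton A X \<Gamma> e a c p * kdelta b d) c d
     + sym2 (\<lambda>c d. weyl_deriv A X \<Gamma> b d e a c p) c d
     + alt2 (\<lambda>e a. sym2 (\<lambda>c d. weyl_deriv A X \<Gamma> b c d e a p) c d) e a"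

definition bivector_comp ::
    "('n \<Rightarrow> 'm form1) \<Rightarrow> 'm bivector \<Rightarrow> 'n \<Rightarrow> 'n \<Rightarrow> 'm \<Rightarrow> real" where
  "bivector_comp \<theta> g b c p = g p (\<theta> b p) (\<theta> c p)"

definition vector_comp :: "('n \<Rightarrow> 'm form1) \<Rightarrow> 'm vfield \<Rightarrow> 'n \<Rightarrow> 'm \<Rightarrow> real" where
  "vector_comp \<theta> \<mu> b p = \<theta> b p (\<mu> p)"

definition D_bivector ::
    "('n::finite \<Rightarrow> 'n \<Rightarrow> 'm form1) \<Rightarrow> ('n \<Rightarrow> 'n \<Rightarrow> 'm \<Rightarrow> real) \<Rightarrow> 'n \<Rightarrow> 'n \<Rightarrow> 'm form1" where
  "D_bivector \<Gamma> g b c = cov_diff0 \<Gamma> (\<lambda>us ls. g (us ! 0) (us ! 1)) [b, c] []"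

definition D_vector ::
    "('n::finite \<Rightarrow> 'n \<Rightarrow> 'm form1) \<Rightarrow> ('n \<Rightarrow> 'm \<Rightarrow> real) \<Rightarrow> 'n \<Rightarrow> 'm form1" where
  "D_vector \<Gamma> \<mu> b = cov_diff0 \<Gamma> (\<lambda>us ls. \<mu> (us ! 0)) [b] []"

definition D_function ::
    "('n::finite \<Rightarrow> 'n \<Rightarrow> 'm form1) \<Rightarrow> ('m \<Rightarrow> real) \<Rightarrow> 'm form1" where
  "D_function \<Gamma> \<rho> = cov_diff0 \<Gamma> (\<lambda>us ls. \<rho>) [] []"

definition D2_vector ::
    "('m::topological_space, 'n::finite) atlas \<Rightarrow> ('n \<Rightarrow> 'n \<Rightarrow> 'm form1) \<Rightarrow> ('n \<Rightarrow> 'm \<Rightarrow> real)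
     \<Rightarrow> 'n \<Rightarrow> 'm form2" where
  "D2_vector A \<Gamma> \<mu> b = cov_diff1 A \<Gamma> (\<lambda>us ls. D_vector \<Gamma> \<mu> (us ! 0)) [b] []"

end

(*
  Antisymmetrizing the derivative of the equation for D mu and inserting the other two equations
  turns the integrability condition into a relation linear in g and mu. The terms in P cancel
  against those of the curvature. In what remains, the second Bianchi identity contracted with g
  trades the traces Y_acd g^cd for derivatives of W, and the first Bianchi identity brings the
  coefficient of mu into the stated form. Both Bianchi identities come from the Jacobi identity
  of the frame fields. The integrability condition itself is the Ricci identity, valid for every
  smooth mu, which carries it from the frame fields to arbitrary vector fields.
*)

theory Submission
  imports Defs
begin

section \<open>Smooth functions and tangent vectors\<close>

text \<open>Two obstacles shape the argument. The frame need not come from coordinates, so frame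
  derivatives do not commute. Torsion-freeness resolves this: it identifies the structure
  coefficients of the frame with the skew part of the connection coefficients,
  \<open>C a b c = G a c b - G a b c\<close>, so curvature, Bianchi identities and second
  derivatives are all written in \<open>G\<close> and its frame derivatives. At a fixed point what
  remains is algebra with real arrays, stated in lemmas free of geometry; the geometry supplies only
  Leibniz rules, commutators and the Jacobi identity. Moreover, fields are total functions,
  meaningful only on \<open>U\<close>. An identity of components must therefore pass through the
  locality of tangent vectors (\<open>tangent_cong\<close>) before it is differentiated. Charts
  enter only through the calculus of smooth functions; the expansion demanded by
  \<open>local_frame\<close> replaces coordinate bases of tangent spaces. An equivalence results,
  and not just an implication, because after use of the Bianchi identities the defects of the two
  equations differ by the nonzero factor \<open>2 / n\<close>.\<close>

lemma Ck_on_subset: "Ck_on k S f \<Longrightarrow> T \<subseteq> S \<Longrightarrow> Ck_on k T f"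
  by (induction k arbitrary: f) (auto intro: continuous_on_subset)

text \<open>A derivative at a point depends on values nearby; since \<open>S\<close> is open,
  agreement on \<open>S\<close> already determines \<open>frechet_derivative\<close> at each of its
  points.\<close>

lemma Ck_on_cong:
  assumes "open S" and "\<And>x. x \<in> S \<Longrightarrow> f x = g x" and "Ck_on k S f"
  shows "Ck_on k S g"
  using assms(2,3)
proof (induction k arbitrary: f g)
  case 0
  then show ?case using continuous_on_cong[of S S f g] by auto
next
  case (Suc k)
  have D: "(g has_derivative frechet_derivative f (at x)) (at x)" if "x \<in> S" for x
    by (rule has_derivative_transform_within_open[OF _ \<open>open S\<close> that, where f = f])
       (use Suc.prems that frechet_derivative_works in auto)
  have E: "frechet_derivative f (at x) = frechet_derivative g (at x)" if "x \<in> S" for x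
    using frechet_derivative_at[OF D[OF that]] .
  have "Ck_on k S (\<lambda>x. frechet_derivative g (at x) v)" for v
    by (rule Suc.IH[of "\<lambda>x. frechet_derivative f (at x) v"]) (use Suc.prems E in auto)
  with D show ?case by (auto simp: differentiable_def)
qed

lemma Ck_on_SucD: "Ck_on (Suc k) S f \<Longrightarrow> Ck_on k S f"
proof (induction k arbitrary: f)
  case 0
  then show ?case
    by (auto intro!: continuous_at_imp_continuous_on differentiable_imp_continuous_within)
next
  case (Suc k)
  then show ?case by (metis Ck_on.simps(2))
qed

lemma Ck_on_const: "Ck_on k S (\<lambda>x. c)"
  by (induction k arbitrary: c) auto

lemma Ck_on_add:
  assumes "open S" and "Ck_on k S f" and "Ck_on k S g"
  shows "Ck_on k S (\<lambda>x. f x + g x)"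
  using assms(2,3)
proof (induction k arbitrary: f g)
  case 0
  then show ?case by (auto intro: continuous_intros)
next
  case (Suc k)
  have E: "frechet_derivative (\<lambda>x. f x + g x) (at x) v
      = frechet_derivative f (at x) v + frechet_derivative g (at x) v"
    if "x \<in> S" for x v
  proof -
    have "((\<lambda>x. f x + g x) has_derivative (\<lambda>v. frechet_derivative f (at x) v
        + frechet_derivative g (at x) v)) (at x)"
      using Suc.prems that by (auto intro!: has_derivative_add simp: frechet_derivative_works)
    from frechet_derivative_at[OF this] show ?thesis by metis
  qed
  have "Ck_on k S (\<lambda>x. frechet_derivative (\<lambda>x. f x + g x) (at x) v)" for v
    by (rule Ck_on_cong[OF \<open>open S\<close>, of "\<lambda>x. frechet_derivative f (at x) v + frechet_derivative g (at x) v"])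
       (use E Suc.IH Suc.prems in auto)
  with Suc.prems show ?case by auto
qed

lemma Ck_on_mult:
  fixes f g :: "'a::euclidean_space \<Rightarrow> real"
  assumes "open S" and "Ck_on k S f" and "Ck_on k S g"
  shows "Ck_on k S (\<lambda>x. f x * g x)"
  using assms(2,3)
proof (induction k arbitrary: f g)
  case 0
  then show ?case by (auto intro: continuous_intros)
next
  case (Suc k)
  have E: "frechet_derivative (\<lambda>x. f x * g x) (at x) v
      = f x * frechet_derivative g (at x) v + frechet_derivative f (at x) v * g x"
    if "x \<in> S" for x v
  proof -
    have "((\<lambda>x. f x * g x) has_derivative (\<lambda>v. f x * frechet_derivative g (at x) v
        + frechet_derivative f (at x) v * g x)) (at x)"
      using Suc.prems that by (auto intro!: has_derivative_mult simp: frechet_derivative_works)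
    from frechet_derivative_at[OF this] show ?thesis by metis
  qed
  \<comment> \<open>The undifferentiated factor has order \<open>Suc k\<close>, the differentiated
    one only \<open>k\<close>; \<open>Ck_on_SucD\<close> lowers the former so that the induction
    hypothesis applies to the pair.\<close>
  have "Ck_on k S (\<lambda>x. f x * frechet_derivative g (at x) v)"
    "Ck_on k S (\<lambda>x. frechet_derivative f (at x) v * g x)" for v
    using Ck_on_SucD[OF Suc.prems(1)] Ck_on_SucD[OF Suc.prems(2)]
      Suc.prems[unfolded Ck_on.simps(2)] by (simp_all add: Suc.IH)
  then have "Ck_on k S (\<lambda>x. frechet_derivative (\<lambda>x. f x * g x) (at x) v)" for v
    by (intro Ck_on_cong[OF \<open>open S\<close> E[symmetric, of _ v]] Ck_on_add[OF \<open>open S\<close>])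
  with Suc.prems show ?case by auto
qed

text \<open>Supplies the open sets on which the \<open>Ck_on\<close> lemmas work in each chart: a
  homeomorphism gives relative openness, which is openness because the whole chart image is
  open.\<close>

lemma open_chart_image:
  assumes "smooth_atlas A" and "(V, \<phi>) \<in> A" and "open W"
  shows "open (\<phi> ` (V \<inter> W))"
proof -
  have V: "open V" "open (\<phi> ` V)" "homeomorphism V (\<phi> ` V) \<phi> (inv_into V \<phi>)"
    using assms(1,2) by (auto simp: smooth_atlas_def)
  have "openin (top_of_set (\<phi> ` V)) (\<phi> ` (V \<inter> W))"
    by (rule homeomorphism_imp_open_map[OF V(3)]) (use assms(3) in \<open>auto simp: openin_open\<close>)
  then show ?thesis using V(2) openin_open_eq by blast
qed

lemma smooth_fun_subset: "smooth_fun A W f \<Longrightarrow> V \<subseteq> W \<Longrightarrow> smooth_fun A V f"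
  unfolding smooth_fun_def smooth_on_def by (blast intro: Ck_on_subset)

lemma smooth_fun_const: "smooth_fun A W (\<lambda>q. c)"
  unfolding smooth_fun_def smooth_on_def comp_def by (auto simp: Ck_on_const)

lemma smooth_fun_add:
  assumes "smooth_atlas A" "open W" "smooth_fun A W f" "smooth_fun A W h"
  shows "smooth_fun A W (\<lambda>q. f q + h q)"
  using assms(3,4) Ck_on_add[OF open_chart_image[OF assms(1) _ assms(2)]]
  unfolding smooth_fun_def smooth_on_def comp_def by blast

lemma smooth_fun_mult:
  assumes "smooth_atlas A" "open W" "smooth_fun A W f" "smooth_fun A W h"
  shows "smooth_fun A W (\<lambda>q. f q * h q)"
  using assms(3,4) Ck_on_mult[OF open_chart_image[OF assms(1) _ assms(2)]]
  unfolding smooth_fun_def smooth_on_def comp_def by blast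

text \<open>\<open>inv_into V \<phi>\<close> maps the chart image of \<open>V \<inter> W\<close>
  back into \<open>W\<close>, so only values on \<open>W\<close> are seen.\<close>

lemma smooth_fun_cong:
  assumes "smooth_atlas A" "open W" "\<And>q. q \<in> W \<Longrightarrow> f q = h q" "smooth_fun A W f"
  shows "smooth_fun A W h"
proof -
  have "Ck_on k (\<phi> ` (V \<inter> W)) (h \<circ> inv_into V \<phi>)" if "(V, \<phi>) \<in> A" for V \<phi> k
  proof (rule Ck_on_cong[OF open_chart_image[OF assms(1) that assms(2)]])
    have "homeomorphism V (\<phi> ` V) \<phi> (inv_into V \<phi>)"
      using assms(1) that by (auto simp: smooth_atlas_def)
    then show "(f \<circ> inv_into V \<phi>) x = (h \<circ> inv_into V \<phi>) x" if "x \<in> \<phi> ` (V \<inter> W)" for x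
      using that assms(3) by (auto simp: homeomorphism_def)
    show "Ck_on k (\<phi> ` (V \<inter> W)) (f \<circ> inv_into V \<phi>)"
      using assms(4) that by (auto simp: smooth_fun_def smooth_on_def)
  qed
  then show ?thesis by (auto simp: smooth_fun_def smooth_on_def)
qed

lemma smooth_fun_uminus:
  assumes "smooth_atlas A" "open W" "smooth_fun A W f"
  shows "smooth_fun A W (\<lambda>q. - f q)"
  using smooth_fun_mult[OF assms(1,2) smooth_fun_const[of _ _ "-1"] assms(3)] by simp

lemma smooth_fun_diff:
  assumes "smooth_atlas A" "open W" "smooth_fun A W f" "smooth_fun A W h"
  shows "smooth_fun A W (\<lambda>q. f q - h q)"
  using smooth_fun_add[OF assms(1-3) smooth_fun_uminus[OF assms(1,2,4)]] by simp

lemma smooth_fun_sum: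
  assumes "smooth_atlas A" "open W" "\<And>i. i \<in> I \<Longrightarrow> smooth_fun A W (f i)"
  shows "smooth_fun A W (\<lambda>q. \<Sum>i\<in>I. f i q)"
  using assms(3)
  by (induction I rule: infinite_finite_induct)
     (auto intro: smooth_fun_const smooth_fun_add[OF assms(1,2)])

lemma smooth_fun_imp_near: "smooth_fun A W f \<Longrightarrow> open W \<Longrightarrow> p \<in> W \<Longrightarrow> smooth_near A p f"
  by (auto simp: smooth_near_def)

lemma smooth_near_common:
  assumes "smooth_near A p f" "smooth_near A p h"
  obtains W where "open W" "p \<in> W" "smooth_fun A W f" "smooth_fun A W h"
proof -
  obtain W1 W2 where "open W1" "p \<in> W1" "smooth_fun A W1 f" "open W2" "p \<in> W2" "smooth_fun A W2 h"
    using assms by (auto simp: smooth_near_def)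
  then show ?thesis
    by (intro that[of "W1 \<inter> W2"]) (auto intro: smooth_fun_subset)
qed

lemma tangent_spaceD:
  assumes "v \<in> tangent_space A p"
  shows "smooth_near A p f \<Longrightarrow> smooth_near A p h \<Longrightarrow> v (\<lambda>q. f q + h q) = v f + v h"
    and "smooth_near A p f \<Longrightarrow> smooth_near A p h \<Longrightarrow> v (\<lambda>q. f q * h q) = f p * v h + h p * v f"
    and "smooth_near A p f \<Longrightarrow> v (\<lambda>q. c * f q) = c * v f"
    and "open W \<Longrightarrow> p \<in> W \<Longrightarrow> \<forall>q\<in>W. f q = h q \<Longrightarrow> v f = v h"
    and "\<not> smooth_near A p f \<Longrightarrow> v f = 0"
  using assms unfolding tangent_space_def mem_Collect_eq by ((elim conjE, iprover)+)

section \<open>Derivation rules for tangent vectors on germs\<close>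

context
  fixes A :: "('m::{t2_space, second_countable_topology}, 'n::finite) atlas"
  assumes atlas: "smooth_atlas A"
begin

lemma smooth_near_const: "smooth_near A p (\<lambda>q. c)"
  using smooth_fun_imp_near[OF smooth_fun_const open_UNIV] by blast

lemma smooth_near_add:
  "smooth_near A p f \<Longrightarrow> smooth_near A p h \<Longrightarrow> smooth_near A p (\<lambda>q. f q + h q)"
  by (erule (1) smooth_near_common) (auto intro!: smooth_fun_imp_near smooth_fun_add[OF atlas])

lemma smooth_near_mult:
  "smooth_near A p f \<Longrightarrow> smooth_near A p h \<Longrightarrow> smooth_near A p (\<lambda>q. f q * h q)"
  by (erule (1) smooth_near_common) (auto intro!: smooth_fun_imp_near smooth_fun_mult[OF atlas])

lemma smooth_near_uminus: "smooth_near A p f \<Longrightarrow> smooth_near A p (\<lambda>q. - f q)"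
  using smooth_near_mult[OF smooth_near_const[of p "-1"]] by simp

lemma smooth_near_diff:
  "smooth_near A p f \<Longrightarrow> smooth_near A p h \<Longrightarrow> smooth_near A p (\<lambda>q. f q - h q)"
  using smooth_near_add[OF _ smooth_near_uminus] by fastforce

lemma smooth_near_sum:
  "(\<And>i. i \<in> I \<Longrightarrow> smooth_near A p (f i)) \<Longrightarrow> smooth_near A p (\<lambda>q. \<Sum>i\<in>I. f i q)"
  by (induction I rule: infinite_finite_induct) (auto intro: smooth_near_const smooth_near_add)

lemmas smooth_near_intros = smooth_near_const smooth_near_add smooth_near_mult
  smooth_near_uminus smooth_near_diff smooth_near_sum

context
  fixes p v assumes v: "v \<in> tangent_space A p"
begin

lemma tangent_add:
  "smooth_near A p f \<Longrightarrow> smooth_near A p h \<Longrightarrow> v (\<lambda>q. f q + h q) = v f + v h"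
  using tangent_spaceD[OF v] by simp

lemma tangent_mult:
  "smooth_near A p f \<Longrightarrow> smooth_near A p h \<Longrightarrow> v (\<lambda>q. f q * h q) = v f * h p + f p * v h"
  using tangent_spaceD[OF v] by simp

lemma tangent_cmult: "smooth_near A p f \<Longrightarrow> v (\<lambda>q. c * f q) = c * v f"
  using tangent_spaceD[OF v] by simp

lemma tangent_cong: "open W \<Longrightarrow> p \<in> W \<Longrightarrow> (\<And>q. q \<in> W \<Longrightarrow> f q = h q) \<Longrightarrow> v f = v h"
  using tangent_spaceD(4)[OF v] by blast

text \<open>The Leibniz rule for 1 * 1 = 1 forces the value 0 at the constant 1; scaling gives the
  other constants.\<close>

lemma tangent_const: "v (\<lambda>q. c) = 0"
  using tangent_mult[OF smooth_near_const[of p 1] smooth_near_const[of p 1]]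
    tangent_cmult[OF smooth_near_const[of p 1], of c] by simp

lemma tangent_uminus: "smooth_near A p f \<Longrightarrow> v (\<lambda>q. - f q) = - v f"
  using tangent_cmult[of f "-1"] by simp

lemma tangent_diff:
  "smooth_near A p f \<Longrightarrow> smooth_near A p h \<Longrightarrow> v (\<lambda>q. f q - h q) = v f - v h"
  using tangent_add[OF _ smooth_near_uminus] tangent_uminus by fastforce

lemma tangent_sum:
  "(\<And>i. i \<in> I \<Longrightarrow> smooth_near A p (f i)) \<Longrightarrow> v (\<lambda>q. \<Sum>i\<in>I. f i q) = (\<Sum>i\<in>I. v (f i))"
  by (induction I rule: infinite_finite_induct)
     (auto simp: tangent_const intro!: tangent_add[THEN trans] smooth_near_sum)

lemmas tangent_simps = tangent_add tangent_mult tangent_const tangent_uminus tangent_diff tangent_sum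

end
end

text \<open>Every clause of \<open>tangent_space\<close> is linear and homogeneous in the vector,
  including the default value 0 off the smooth germs.\<close>

lemma tangent_space_lincomb:
  assumes v: "v \<in> tangent_space A p" and w: "w \<in> tangent_space A p"
  shows "(\<lambda>f. a * v f + b * w f) \<in> tangent_space A p"
  unfolding tangent_space_def mem_Collect_eq
proof (intro conjI allI impI)
  show "a * v f + b * w f = a * v h + b * w h"
    if "open W" "p \<in> W" "\<forall>q\<in>W. f q = h q" for W f h
    using tangent_spaceD(4)[OF v that] tangent_spaceD(4)[OF w that] by simp
qed (simp_all add: tangent_spaceD[OF v] tangent_spaceD[OF w] distrib_left mult.left_commute)

lemma tangent_space_scale: "v \<in> tangent_space A p \<Longrightarrow> (\<lambda>f. c * v f) \<in> tangent_space A p"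
  using tangent_space_lincomb[of v A p v c 0] by simp

lemma tangent_space_add:
  "v \<in> tangent_space A p \<Longrightarrow> w \<in> tangent_space A p \<Longrightarrow> (\<lambda>f. v f + w f) \<in> tangent_space A p"
  using tangent_space_lincomb[of v A p w 1 1] by simp

lemma tangent_space_diff:
  "v \<in> tangent_space A p \<Longrightarrow> w \<in> tangent_space A p \<Longrightarrow> (\<lambda>f. v f - w f) \<in> tangent_space A p"
  using tangent_space_lincomb[of v A p w 1 "-1"] by simp

lemma cotangent_add:
  "\<alpha> \<in> cotangent_space A p \<Longrightarrow> v \<in> tangent_space A p \<Longrightarrow> w \<in> tangent_space A p \<Longrightarrow>
     \<alpha> (\<lambda>f. v f + w f) = \<alpha> v + \<alpha> w"
  by (auto simp: cotangent_space_def)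

lemma cotangent_scale:
  "\<alpha> \<in> cotangent_space A p \<Longrightarrow> v \<in> tangent_space A p \<Longrightarrow> \<alpha> (\<lambda>f. c * v f) = c * \<alpha> v"
  by (auto simp: cotangent_space_def)

lemma cotangent_diff:
  assumes "\<alpha> \<in> cotangent_space A p" "v \<in> tangent_space A p" "w \<in> tangent_space A p"
  shows "\<alpha> (\<lambda>f. v f - w f) = \<alpha> v - \<alpha> w"
  using cotangent_add[OF assms(1,2) tangent_space_scale[OF assms(3)], of "-1"]
    cotangent_scale[OF assms(1,3), of "-1"] by simp

lemma vector_field_subset: "vector_field A W X \<Longrightarrow> V \<subseteq> W \<Longrightarrow> vector_field A V X"
  unfolding vector_field_def by (meson order_trans subsetD)

section \<open>Component identities at a point\<close>

lemma sum_kdelta [simp]: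
  fixes a :: "'n::finite"
  shows "(\<Sum>c\<in>UNIV. kdelta a c * f c) = f a" "(\<Sum>c\<in>UNIV. kdelta c a * f c) = f a"
    "(\<Sum>c\<in>UNIV. f c * kdelta a c) = f a" "(\<Sum>c\<in>UNIV. f c * kdelta c a) = f a"
  by (simp_all add: kdelta_def if_distrib[of "\<lambda>x. _ * x"] if_distrib[of "\<lambda>x. x * _"] cong: if_cong)

text \<open>
  At a fixed point, \<open>G a b c\<close> stands for the connection coefficient with direction of differentiation
  \<open>c\<close>, \<open>G1\<close> and \<open>G2\<close> for its first and second derivatives along the frame (differentiating fields
  first), \<open>C f c d\<close> for the \<open>f\<close>-component of the bracket of the frame fields \<open>c\<close> and \<open>d\<close>, \<open>C1\<close> and
  \<open>R1\<close> for the derivatives of \<open>C\<close> and of the curvature \<open>R\<close>.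
\<close>

lemma bianchi1_algebra:
  fixes G :: "'n::finite \<Rightarrow> 'n \<Rightarrow> 'n \<Rightarrow> real" and G1 :: "'n \<Rightarrow> 'n \<Rightarrow> 'n \<Rightarrow> 'n \<Rightarrow> real"
  assumes C: "\<And>f c d. C f c d = G f d c - G f c d"
    and C1: "\<And>e f c d. C1 e f c d = G1 e f d c - G1 e f c d"
    and jac: "\<And>a b c d. C1 b a c d + C1 c a d b + C1 d a b c
      + (\<Sum>e\<in>UNIV. C e c d * C a b e + C e d b * C a c e + C e b c * C a d e) = 0"
    and R: "\<And>a b c d. R a b c d = G1 c a b d - G1 d a b c - (\<Sum>e\<in>UNIV. C e c d * G a b e)
      + (\<Sum>e\<in>UNIV. G a e c * G e b d - G a e d * G e b c)"
  shows "R a b c d + R a c d b + R a d b c = 0"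
proof -
  \<comment> \<open>In \<open>C e c d * C a b e\<close> split \<open>C a b e\<close>. The part with
    \<open>G a b e\<close> is the bracket term of a curvature; the part with \<open>G a e b\<close>,
    after splitting \<open>C e c d\<close> too, gives the quadratic terms in the cyclic sum. The
    linear terms match through \<open>C1\<close>, so the cyclic sum of curvatures is the Jacobi
    expression.\<close>
  have "(\<Sum>e\<in>UNIV. C e c d * C a b e + C e d b * C a c e + C e b c * C a d e)
    = - (\<Sum>e\<in>UNIV. C e c d * G a b e) - (\<Sum>e\<in>UNIV. C e d b * G a c e) - (\<Sum>e\<in>UNIV. C e b c * G a d e)
      + (\<Sum>e\<in>UNIV. G a e c * G e b d - G a e d * G e b c)
      + (\<Sum>e\<in>UNIV. G a e d * G e c b - G a e b * G e c d)
      + (\<Sum>e\<in>UNIV. G a e b * G e d c - G a e c * G e d b)"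
    unfolding C sum_negf[symmetric] sum.distrib[symmetric] sum_subtractf[symmetric]
    by (rule sum.cong) (simp_all add: algebra_simps)
  then show ?thesis
    using jac[of b a c d] unfolding R C1 by linarith
qed

text \<open>In the cyclic sum the connection terms on the last two curvature indices occur only
  through skew parts of \<open>G\<close>, hence through \<open>C\<close>. They absorb the
  commutators of second derivatives, and the Jacobi identity removes the rest.\<close>

lemma bianchi2_algebra:
  fixes G :: "'n::finite \<Rightarrow> 'n \<Rightarrow> 'n \<Rightarrow> real" and G1 :: "'n \<Rightarrow> 'n \<Rightarrow> 'n \<Rightarrow> 'n \<Rightarrow> real"
    and G2 :: "'n \<Rightarrow> 'n \<Rightarrow> 'n \<Rightarrow> 'n \<Rightarrow> 'n \<Rightarrow> real"
  assumes C: "\<And>f c d. C f c d = G f d c - G f c d"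
    and C1: "\<And>e f c d. C1 e f c d = G1 e f d c - G1 e f c d"
    and comm: "\<And>e c a b d. G2 e c a b d - G2 c e a b d = (\<Sum>f\<in>UNIV. C f e c * G1 f a b d)"
    and jac: "\<And>a b c d. C1 b a c d + C1 c a d b + C1 d a b c
      + (\<Sum>e\<in>UNIV. C e c d * C a b e + C e d b * C a c e + C e b c * C a d e) = 0"
    and R: "\<And>a b c d. R a b c d = G1 c a b d - G1 d a b c - (\<Sum>e\<in>UNIV. C e c d * G a b e)
      + (\<Sum>e\<in>UNIV. G a e c * G e b d - G a e d * G e b c)"
    and R1: "\<And>e a b c d. R1 e a b c d = G2 e c a b d - G2 e d a b c
      - (\<Sum>f\<in>UNIV. C1 e f c d * G a b f + C f c d * G1 e a b f)
      + (\<Sum>f\<in>UNIV. G1 e a f c * G f b d + G a f c * G1 e f b d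
           - (G1 e a f d * G f b c + G a f d * G1 e f b c))"
    and nR: "\<And>e a b c d. nR a b c d e = R1 e a b c d + (\<Sum>f\<in>UNIV. G a f e * R f b c d)
      - (\<Sum>f\<in>UNIV. G f b e * R a f c d) - (\<Sum>f\<in>UNIV. G f c e * R a b f d)
      - (\<Sum>f\<in>UNIV. G f d e * R a b c f)"
  shows "nR a b c d e + nR a b d e c + nR a b e c d = 0"
proof -
  have Canti: "C f c d = - C f d c" for f c d by (simp add: C)
  have Ranti: "R a b c d = - R a b d c" for a b c d
  proof -
    have "(\<Sum>e\<in>UNIV. C e c d * G a b e) = - (\<Sum>e\<in>UNIV. C e d c * G a b e)"
      by (subst Canti) (simp add: sum_negf)
    then show ?thesis by (simp add: R sum_subtractf)
  qed
  \<comment> \<open>Each kind of sum of products gets a letter, which makes the final claim linear.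
    In the cyclic sum \<open>u\<close>, \<open>v\<close>, \<open>q\<close> cancel between
    \<open>R1\<close> and the connection terms on \<open>a\<close> and \<open>b\<close>;
    \<open>x\<close>, \<open>w\<close>, \<open>k\<close>, \<open>l\<close> cancel against the
    contraction of \<open>C\<close> with \<open>R\<close> in \<open>4\<close>. What is left is minus
    the cyclic sum of \<open>y\<close> and \<open>z\<close>, which \<open>8\<close>
    annihilates.\<close>
  define u where "u e c d = (\<Sum>f\<in>UNIV. G1 e a f c * G f b d)" for e c d
  define v where "v e c d = (\<Sum>f\<in>UNIV. G a f c * G1 e f b d)" for e c d
  define w where "w e c d = (\<Sum>f\<in>UNIV. C f c d * G1 e a b f)" for e c d
  define x where "x e c d = (\<Sum>f\<in>UNIV. C f e c * G1 f a b d)" for e c d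
  define y where "y e c d = (\<Sum>f\<in>UNIV. C1 e f c d * G a b f)" for e c d
  define q where "q e c d = (\<Sum>f\<in>UNIV. \<Sum>h\<in>UNIV. G a f e * (G f h c * G h b d))" for e c d
  define k where "k e c d = (\<Sum>f\<in>UNIV. \<Sum>h\<in>UNIV. C h c d * (G a f e * G f b h))" for e c d
  define l where "l e c d = (\<Sum>f\<in>UNIV. \<Sum>h\<in>UNIV. C h c d * (G a f h * G f b e))" for e c d
  define z where "z e c d = (\<Sum>f\<in>UNIV. \<Sum>h\<in>UNIV. C h c d * (C f e h * G a b f))" for e c d
  have 1: "R1 e a b c d = G2 e c a b d - G2 e d a b c - y e c d - w e c d
      + u e c d + v e c d - u e d c - v e d c" for e c d
    unfolding R1 u_def v_def w_def y_def by (simp add: sum.distrib sum_subtractf)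
  have 2: "(\<Sum>f\<in>UNIV. G a f e * R f b c d) = v c e d - v d e c - k e c d + q e c d - q e d c" for e c d
    unfolding R v_def k_def q_def
    by (simp add: sum.distrib sum_subtractf sum_distrib_left right_diff_distrib distrib_left mult.left_commute)
  have qq: "(\<Sum>f\<in>UNIV. \<Sum>h\<in>UNIV. G f b e * (G a h c * G h f d)) = q c d e" for c d e
    unfolding q_def by (subst sum.swap) (simp add: mult.commute mult.left_commute)
  have 3: "(\<Sum>f\<in>UNIV. G f b e * R a f c d) = u c d e - u d c e - l e c d + q c d e - q d c e" for e c d
    unfolding R u_def l_def qq[symmetric]
    by (simp add: sum.distrib sum_subtractf sum_distrib_left right_diff_distrib distrib_left mult.commute mult.left_commute)
  have zz: "(\<Sum>f\<in>UNIV. \<Sum>h\<in>UNIV. C f e c * (C h f d * G a b h)) = - z d e c" for e c d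
    unfolding z_def by (subst sum.swap, subst Canti[of _ d]) (simp add: sum_negf)
  have 4: "(\<Sum>f\<in>UNIV. C f e c * R a b f d) = x e c d - w d e c + z d e c
     + l d e c - k d e c" for e c d
  proof -
    have l: "(\<Sum>f\<in>UNIV. \<Sum>h\<in>UNIV. C f e c * (G a h f * G h b d)) = l d e c"
      unfolding l_def by (subst sum.swap) simp
    have k: "(\<Sum>f\<in>UNIV. \<Sum>h\<in>UNIV. C f e c * (G a h d * G h b f)) = k d e c"
      unfolding k_def by (subst sum.swap) simp
    show ?thesis
      unfolding R w_def x_def l[symmetric] k[symmetric]
      using zz[of e c d]
      by (simp add: sum.distrib sum_subtractf sum_distrib_left right_diff_distrib distrib_left)
  qed
  have 6: "(\<Sum>f\<in>UNIV. G f d e * R a b c f) = - (\<Sum>f\<in>UNIV. G f d e * R a b f c)" for c d e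
    by (subst Ranti) (simp add: sum_negf)
  have 7: "(\<Sum>f\<in>UNIV. G f e c * R a b f d) - (\<Sum>f\<in>UNIV. G f c e * R a b f d)
      = (\<Sum>f\<in>UNIV. C f c e * R a b f d)" for c d e
    unfolding C by (simp add: left_diff_distrib sum_subtractf)
  have 8: "y e c d + y c d e + y d e c + (z e c d + z c d e + z d e c) = 0"
  proof -
    have "y e c d + y c d e + y d e c = (\<Sum>f\<in>UNIV. (C1 e f c d + C1 c f d e + C1 d f e c) * G a b f)"
      unfolding y_def by (simp add: sum.distrib distrib_right)
    also have "\<dots> = - (\<Sum>f\<in>UNIV. (\<Sum>h\<in>UNIV. C h c d * C f e h + C h d e * C f c h + C h e c * C f d h) * G a b f)"
      unfolding sum_negf[symmetric]
      by (rule sum.cong[OF refl]) (use jac in \<open>simp add: eq_neg_iff_add_eq_0 flip: distrib_right\<close>)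
    also have "\<dots> = - (z e c d + z c d e + z d e c)"
      unfolding z_def by (simp add: sum.distrib sum_distrib_right distrib_right mult.assoc)
    finally show ?thesis by simp
  qed
  have 9: "G2 e c a b d - G2 c e a b d = x e c d" for e c d
    using comm unfolding x_def .
  show ?thesis
    unfolding nR 1 2 3 6
    using 4[of e c d] 4[of c d e] 4[of d e c] 7[of c e d] 7[of e d c] 7[of d c e] 8
     9[of e c d] 9[of c d e] 9[of d e c]
    by (smt (verit))
qed

text \<open>In the next two lemmas \<open>H b f\<close> is the connection coefficient in a fixed direction.\<close>

lemma covariant_contraction_2:
  fixes H P g dP dg :: "'n::finite \<Rightarrow> 'n \<Rightarrow> real"
  shows "(\<Sum>c\<in>UNIV. dP e c * g b c + P e c * dg b c)
      + (\<Sum>f\<in>UNIV. H b f * (\<Sum>c\<in>UNIV. P e c * g f c)) - (\<Sum>f\<in>UNIV. H f e * (\<Sum>c\<in>UNIV. P f c * g b c))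
    = (\<Sum>c\<in>UNIV. (dP e c - (\<Sum>f\<in>UNIV. H f e * P f c) - (\<Sum>f\<in>UNIV. H f c * P e f)) * g b c
        + P e c * (dg b c + (\<Sum>f\<in>UNIV. H b f * g f c) + (\<Sum>f\<in>UNIV. H c f * g b f)))"
proof -
  have 1: "(\<Sum>f\<in>UNIV. H b f * (\<Sum>c\<in>UNIV. P e c * g f c)) = (\<Sum>c\<in>UNIV. P e c * (\<Sum>f\<in>UNIV. H b f * g f c))"
    unfolding sum_distrib_left by (subst sum.swap) (simp add: mult.left_commute)
  have 2: "(\<Sum>f\<in>UNIV. H f e * (\<Sum>c\<in>UNIV. P f c * g b c)) = (\<Sum>c\<in>UNIV. (\<Sum>f\<in>UNIV. H f e * P f c) * g b c)"
    unfolding sum_distrib_left sum_distrib_right by (subst sum.swap) (simp add: mult.assoc)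
  \<comment> \<open>The summed index is lower in \<open>P\<close> and upper in \<open>g\<close>, so
    its two connection terms cancel and only those for \<open>b\<close> and \<open>e\<close>
    survive.\<close>
  have 3: "(\<Sum>c\<in>UNIV. (\<Sum>f\<in>UNIV. H f c * P e f) * g b c) = (\<Sum>c\<in>UNIV. P e c * (\<Sum>f\<in>UNIV. H c f * g b f))"
    unfolding sum_distrib_left sum_distrib_right by (subst sum.swap) (simp add: ac_simps)
  show ?thesis
    unfolding 1 2 using 3
    by (simp add: sum.distrib sum_subtractf left_diff_distrib distrib_left)
qed

text \<open>The Leibniz rule for a double contraction: the connection terms of both summed indices
  cancel between \<open>W\<close> and \<open>g\<close>, leaving those of the free indices
  \<open>b\<close> and \<open>e\<close>.\<close>

lemma covariant_contraction_4:
  fixes H g dg :: "'n::finite \<Rightarrow> 'n \<Rightarrow> real" and W dW :: "'n \<Rightarrow> 'n \<Rightarrow> 'n \<Rightarrow> 'n \<Rightarrow> real"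
  shows "(\<Sum>c\<in>UNIV. \<Sum>d\<in>UNIV. dW b c d e * g c d + W b c d e * dg c d)
      + (\<Sum>f\<in>UNIV. H b f * (\<Sum>c\<in>UNIV. \<Sum>d\<in>UNIV. W f c d e * g c d))
      - (\<Sum>f\<in>UNIV. H f e * (\<Sum>c\<in>UNIV. \<Sum>d\<in>UNIV. W b c d f * g c d))
    = (\<Sum>c\<in>UNIV. \<Sum>d\<in>UNIV. (dW b c d e + (\<Sum>f\<in>UNIV. H b f * W f c d e)
          - (\<Sum>f\<in>UNIV. H f c * W b f d e) - (\<Sum>f\<in>UNIV. H f d * W b c f e)
          - (\<Sum>f\<in>UNIV. H f e * W b c d f)) * g c d
        + W b c d e * (dg c d + (\<Sum>f\<in>UNIV. H c f * g f d) + (\<Sum>f\<in>UNIV. H d f * g c f)))"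
proof -
  have out: "(\<Sum>f\<in>UNIV. h f * (\<Sum>c\<in>UNIV. \<Sum>d\<in>UNIV. w f c d * g c d))
      = (\<Sum>c\<in>UNIV. \<Sum>d\<in>UNIV. (\<Sum>f\<in>UNIV. h f * w f c d) * g c d)" for h and w :: "'n \<Rightarrow> 'n \<Rightarrow> 'n \<Rightarrow> real"
  proof -
    have "(\<Sum>f\<in>UNIV. h f * (\<Sum>c\<in>UNIV. \<Sum>d\<in>UNIV. w f c d * g c d))
      = (\<Sum>f\<in>UNIV. \<Sum>c\<in>UNIV. \<Sum>d\<in>UNIV. h f * w f c d * g c d)"
      by (simp add: sum_distrib_left mult.assoc)
    also have "\<dots> = (\<Sum>c\<in>UNIV. \<Sum>f\<in>UNIV. \<Sum>d\<in>UNIV. h f * w f c d * g c d)"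
      by (rule sum.swap)
    also have "\<dots> = (\<Sum>c\<in>UNIV. \<Sum>d\<in>UNIV. \<Sum>f\<in>UNIV. h f * w f c d * g c d)"
      by (rule sum.cong[OF refl], rule sum.swap)
    finally show ?thesis by (simp add: sum_distrib_right)
  qed
  have 1: "(\<Sum>c\<in>UNIV. \<Sum>d\<in>UNIV. (\<Sum>f\<in>UNIV. H f d * W b c f e) * g c d)
      = (\<Sum>c\<in>UNIV. \<Sum>d\<in>UNIV. W b c d e * (\<Sum>f\<in>UNIV. H d f * g c f))"
    unfolding sum_distrib_left sum_distrib_right
    by (rule sum.cong[OF refl], subst sum.swap) (simp add: ac_simps)
  have 2: "(\<Sum>c\<in>UNIV. \<Sum>d\<in>UNIV. (\<Sum>f\<in>UNIV. H f c * W b f d e) * g c d)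
      = (\<Sum>c\<in>UNIV. \<Sum>d\<in>UNIV. W b c d e * (\<Sum>f\<in>UNIV. H c f * g f d))"
  proof -
    have "(\<Sum>c\<in>UNIV. \<Sum>d\<in>UNIV. (\<Sum>f\<in>UNIV. H f c * W b f d e) * g c d)
        = (\<Sum>d\<in>UNIV. \<Sum>c\<in>UNIV. \<Sum>f\<in>UNIV. H f c * W b f d e * g c d)"
      by (subst sum.swap) (simp add: sum_distrib_right)
    also have "\<dots> = (\<Sum>d\<in>UNIV. \<Sum>f\<in>UNIV. \<Sum>c\<in>UNIV. H f c * W b f d e * g c d)"
      by (rule sum.cong[OF refl], rule sum.swap)
    also have "\<dots> = (\<Sum>f\<in>UNIV. \<Sum>d\<in>UNIV. \<Sum>c\<in>UNIV. H f c * W b f d e * g c d)"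
      by (rule sum.swap)
    finally show ?thesis by (simp add: sum_distrib_left ac_simps)
  qed
  show ?thesis
    unfolding out using 1 2
    by (simp add: sum.distrib sum_subtractf left_diff_distrib distrib_left distrib_right)
qed

text \<open>The prefix \<open>n\<close> marks covariant derivatives; \<open>DN\<close> is that of the covariant differential of \<open>\<mu>\<close>.\<close>

lemma integrability_algebra:
  fixes W :: "'n::finite \<Rightarrow> 'n \<Rightarrow> 'n \<Rightarrow> 'n \<Rightarrow> real" and \<nu> :: real
  assumes \<nu>: "\<nu> \<noteq> 0"
    and g: "\<And>c d. g c d = g d c"
    and P: "\<And>c d. P c d = P d c"
    and R: "\<And>a b c d. R a b c d = W a b c d + kdelta a c * P d b - kdelta a d * P c b"
    and Y: "\<And>a b c. Y b c a = nP c a b - nP b a c"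
    and W: "\<And>a b c d. W a b c d = - W a b d c"
    and nW: "\<And>a b c d e. nW a b c d e = - nW a b d c e"
    and bianchi1: "\<And>a b c d. W a b c d + W a c d b + W a d b c = 0"
    and bianchi2: "\<And>a b c d e. nW b d e a c + nW b d a c e + nW b d c e a
      = - (kdelta b a * Y e c d + kdelta b c * Y a e d + kdelta b e * Y c a d)"
    and D\<rho>: "\<And>a. D\<rho> a = - 2 * (\<Sum>c\<in>UNIV. P a c * \<mu> c) + 2 / \<nu> * (\<Sum>c\<in>UNIV. \<Sum>d\<in>UNIV. Y a c d * g c d)"
    and DN: "\<And>a b e. DN b e a = D\<rho> a * kdelta b e
      - (\<Sum>c\<in>UNIV. nP e c a * g b c + P e c * (\<mu> c * kdelta b a + \<mu> b * kdelta c a))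
      - 1 / \<nu> * (\<Sum>c\<in>UNIV. \<Sum>d\<in>UNIV. nW b c d e a * g c d + W b c d e * (\<mu> d * kdelta c a + \<mu> c * kdelta d a))"
  shows "DN b e a - DN b a e = (\<Sum>c\<in>UNIV. R b c a e * \<mu> c) \<longleftrightarrow>
    (\<Sum>c\<in>UNIV. \<Sum>d\<in>UNIV. ((\<nu> - 2) / 2 * sym2 (\<lambda>c d. Y e a c * kdelta b d) c d
       + sym2 (\<lambda>c d. nW b d e a c) c d
       + alt2 (\<lambda>e a. sym2 (\<lambda>c d. nW b c d e a) c d) e a) * g c d)
    = (\<Sum>c\<in>UNIV. ((\<nu> + 4) / 2 * W b c a e + alt2 (\<lambda>a e. W b a e c) a e) * \<mu> c)"
proof -
  have flip: "(\<Sum>c\<in>UNIV. \<Sum>d\<in>UNIV. T d c * g c d) = (\<Sum>c\<in>UNIV. \<Sum>d\<in>UNIV. T c d * g c d)" for T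
    by (subst sum.swap) (simp add: g)
  have sym: "(\<Sum>c\<in>UNIV. \<Sum>d\<in>UNIV. sym2 T c d * g c d) = (\<Sum>c\<in>UNIV. \<Sum>d\<in>UNIV. T c d * g c d)" for T
  proof -
    have "(\<Sum>c\<in>UNIV. \<Sum>d\<in>UNIV. sym2 T c d * g c d)
      = ((\<Sum>c\<in>UNIV. \<Sum>d\<in>UNIV. T c d * g c d) + (\<Sum>c\<in>UNIV. \<Sum>d\<in>UNIV. T d c * g c d)) / 2"
      by (simp add: sym2_def sum.distrib[symmetric] sum_divide_distrib distrib_right)
    then show ?thesis using flip[of T] by simp
  qed
  define yg where "yg a = (\<Sum>c\<in>UNIV. \<Sum>d\<in>UNIV. Y a c d * g c d)" for a
  define y where "y = (\<Sum>c\<in>UNIV. Y e a c * g b c)"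
  define v where "v = (\<Sum>c\<in>UNIV. \<Sum>d\<in>UNIV. nW b d e a c * g c d)"
  define t where "t e a = (\<Sum>c\<in>UNIV. \<Sum>d\<in>UNIV. nW b c d e a * g c d)" for e a
  define w where "w = (\<Sum>c\<in>UNIV. W b c a e * \<mu> c)"
  define u where "u a e = (\<Sum>c\<in>UNIV. W b a e c * \<mu> c)" for a e
  define q where "q a = (\<Sum>c\<in>UNIV. P a c * \<mu> c)" for a
  have B1: "w + u a e - u e a = 0"
  proof -
    have "w + u a e - u e a = (\<Sum>c\<in>UNIV. (W b c a e + W b a e c + W b e c a) * \<mu> c)"
      unfolding w_def u_def using W[of b e a]
      by (simp add: sum.distrib[symmetric] sum_subtractf[symmetric] distrib_right)
    then show ?thesis using bianchi1 by simp
  qed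
  have Yanti: "Y b c a = - Y c b a" for a b c by (simp add: Y)
  \<comment> \<open>The second Bianchi identity contracted with \<open>g\<close> over
    \<open>c\<close> and \<open>d\<close>. Symmetry of \<open>g\<close> puts the slots of
    \<open>t\<close> in the order the identity requires. The traces on the right are exactly those
    that \<open>D\<rho>\<close> introduces.\<close>
  have B2: "v + t e a - t a e = kdelta b e * yg a - kdelta b a * yg e + y"
  proof -
    have "v + t e a - t a e
        = (\<Sum>c\<in>UNIV. \<Sum>d\<in>UNIV. (nW b d e a c + nW b d a c e + nW b d c e a) * g c d)"
    proof -
      have "t e a = (\<Sum>c\<in>UNIV. \<Sum>d\<in>UNIV. nW b d c e a * g c d)"
        "t a e = (\<Sum>c\<in>UNIV. \<Sum>d\<in>UNIV. nW b d c a e * g c d)"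
        unfolding t_def by (rule flip[symmetric])+
      then show ?thesis
        unfolding v_def using nW[of b _ a _ e]
        by (simp add: sum.distrib[symmetric] sum_subtractf[symmetric] algebra_simps)
    qed
    also have "\<dots> = (\<Sum>c\<in>UNIV. \<Sum>d\<in>UNIV. kdelta b e * (Y a c d * g c d))
        - (\<Sum>c\<in>UNIV. \<Sum>d\<in>UNIV. kdelta b a * (Y e c d * g c d))
        + (\<Sum>c\<in>UNIV. \<Sum>d\<in>UNIV. kdelta b c * (Y e a d * g c d))"
      unfolding bianchi2 using Yanti[of a e] Yanti[of _ a]
      by (simp add: sum.distrib[symmetric] sum_subtractf[symmetric] algebra_simps)
    also have "\<dots> = kdelta b e * yg a - kdelta b a * yg e + y"
      unfolding yg_def y_def by (simp add: sum_distrib_left[symmetric])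
    finally show ?thesis .
  qed
  have N: "DN b e a = D\<rho> a * kdelta b e - (\<Sum>c\<in>UNIV. nP e c a * g b c) - kdelta b a * q e - \<mu> b * P e a
      - 1 / \<nu> * (t e a + (\<Sum>c\<in>UNIV. W b a c e * \<mu> c) + (\<Sum>c\<in>UNIV. W b c a e * \<mu> c))" for a e
  proof -
    have "(\<Sum>c\<in>UNIV. nP e c a * g b c + P e c * (\<mu> c * kdelta b a + \<mu> b * kdelta c a))
        = (\<Sum>c\<in>UNIV. nP e c a * g b c) + kdelta b a * q e + \<mu> b * P e a"
    proof -
      have "(\<Sum>c\<in>UNIV. P e c * (\<mu> b * kdelta c a)) = \<mu> b * P e a"
        unfolding mult.left_commute[of _ "\<mu> b"] sum_distrib_left[symmetric] by simp
      then show ?thesis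
        unfolding q_def by (simp add: sum.distrib distrib_left sum_distrib_left ac_simps)
    qed
    moreover have "(\<Sum>c\<in>UNIV. \<Sum>d\<in>UNIV. nW b c d e a * g c d + W b c d e * (\<mu> d * kdelta c a + \<mu> c * kdelta d a))
        = t e a + (\<Sum>c\<in>UNIV. W b a c e * \<mu> c) + (\<Sum>c\<in>UNIV. W b c a e * \<mu> c)"
    proof -
      have "(\<Sum>c\<in>UNIV. \<Sum>d\<in>UNIV. W b c d e * (\<mu> d * kdelta c a))
          = (\<Sum>c\<in>UNIV. (\<Sum>d\<in>UNIV. W b c d e * \<mu> d) * kdelta c a)"
        by (simp add: sum_distrib_right mult.assoc)
      moreover have "(\<Sum>c\<in>UNIV. \<Sum>d\<in>UNIV. W b c d e * (\<mu> c * kdelta d a)) = (\<Sum>c\<in>UNIV. W b c a e * \<mu> c)"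
        by (simp add: mult.assoc[symmetric])
      ultimately show ?thesis unfolding t_def by (simp add: sum.distrib distrib_left)
    qed
    ultimately show ?thesis unfolding DN by simp
  qed
  have W1: "(\<Sum>c\<in>UNIV. W b a c e * \<mu> c) = - u a e" "(\<Sum>c\<in>UNIV. W b e c a * \<mu> c) = - u e a"
     "(\<Sum>c\<in>UNIV. W b c e a * \<mu> c) = - w"
    unfolding u_def w_def by (subst W, simp add: sum_negf)+
  have Y1: "(\<Sum>c\<in>UNIV. nP e c a * g b c) - (\<Sum>c\<in>UNIV. nP a c e * g b c) = - y"
    unfolding y_def Y by (simp add: left_diff_distrib sum_subtractf)
  \<comment> \<open>The terms \<open>\<mu> b * P e a\<close> disappear here by symmetry of
    \<open>P\<close>.\<close>
  have L: "DN b e a - DN b a e = D\<rho> a * kdelta b e - D\<rho> e * kdelta b a + y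
      - kdelta b a * q e + kdelta b e * q a - 1 / \<nu> * (t e a - t a e - u a e + u e a + 2 * w)"
    unfolding N W1 w_def[symmetric] using Y1 P[of e a] by (simp add: algebra_simps)
  \<comment> \<open>These are the \<open>P\<close> terms of \<open>L\<close>: -2 from
    \<open>D\<rho>\<close> and +1 from the derivative of \<open>g\<close> leave -1 as coefficient of
    \<open>kdelta b e * q a\<close>, and oppositely for \<open>kdelta b a * q e\<close>.\<close>
  have R': "(\<Sum>c\<in>UNIV. R b c a e * \<mu> c) = w + kdelta b a * q e - kdelta b e * q a"
    unfolding R w_def q_def
    by (simp add: sum.distrib sum_subtractf distrib_right left_diff_distrib sum_distrib_left mult.assoc)
  have S: "(\<Sum>c\<in>UNIV. \<Sum>d\<in>UNIV. ((\<nu> - 2) / 2 * sym2 (\<lambda>c d. Y e a c * kdelta b d) c d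
       + sym2 (\<lambda>c d. nW b d e a c) c d
       + alt2 (\<lambda>e a. sym2 (\<lambda>c d. nW b c d e a) c d) e a) * g c d)
    = (\<nu> - 2) / 2 * y + v + (t e a - t a e) / 2"
  proof -
    have "(\<Sum>c\<in>UNIV. \<Sum>d\<in>UNIV. ((\<nu> - 2) / 2 * sym2 (\<lambda>c d. Y e a c * kdelta b d) c d
       + sym2 (\<lambda>c d. nW b d e a c) c d
       + alt2 (\<lambda>e a. sym2 (\<lambda>c d. nW b c d e a) c d) e a) * g c d)
      = (\<nu> - 2) / 2 * (\<Sum>c\<in>UNIV. \<Sum>d\<in>UNIV. sym2 (\<lambda>c d. Y e a c * kdelta b d) c d * g c d)
       + (\<Sum>c\<in>UNIV. \<Sum>d\<in>UNIV. sym2 (\<lambda>c d. nW b d e a c) c d * g c d)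
       + ((\<Sum>c\<in>UNIV. \<Sum>d\<in>UNIV. sym2 (\<lambda>c d. nW b c d e a) c d * g c d)
        - (\<Sum>c\<in>UNIV. \<Sum>d\<in>UNIV. sym2 (\<lambda>c d. nW b c d a e) c d * g c d)) / 2"
      unfolding alt2_def
      by (simp only: sum.distrib sum_subtractf sum_distrib_left sum_divide_distrib distrib_right
          left_diff_distrib diff_divide_distrib times_divide_eq_left times_divide_eq_right mult.assoc)
    also have "(\<Sum>c\<in>UNIV. \<Sum>d\<in>UNIV. sym2 (\<lambda>c d. Y e a c * kdelta b d) c d * g c d) = y"
      unfolding sym y_def by (simp add: mult.assoc g[of _ b] sum_distrib_left[symmetric])
    finally show ?thesis unfolding sym v_def t_def by simp
  qed
  have R2: "(\<Sum>c\<in>UNIV. ((\<nu> + 4) / 2 * W b c a e + alt2 (\<lambda>a e. W b a e c) a e) * \<mu> c)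
      = (\<nu> + 4) / 2 * w + (u a e - u e a) / 2"
    unfolding alt2_def w_def u_def
    by (simp only: sum.distrib sum_subtractf sum_distrib_left sum_divide_distrib distrib_right
          left_diff_distrib diff_divide_distrib times_divide_eq_left times_divide_eq_right mult.assoc)
  \<comment> \<open>Origin of the constants: \<open>D\<rho>\<close> carries \<open>2 / \<nu>\<close>
    times the traces \<open>yg\<close>. Eliminating them by \<open>B2\<close> reduces the
    coefficient of \<open>y\<close> from 1 to \<open>1 - 2 / \<nu>\<close>, which is
    \<open>2 / \<nu> * ((\<nu> - 2) / 2)\<close>, and turns that of \<open>t e a - t a e\<close>
    from \<open>- 1 / \<nu>\<close> into \<open>1 / \<nu>\<close>. The \<open>\<mu>\<close> terms
    come out as minus \<open>2 / \<nu> * ((\<nu> + 2) / 2 * w + (u e a - u a e) / 2)\<close>; since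
    \<open>w = u e a - u a e\<close> by \<open>B1\<close>, this is the stated form with
    \<open>(\<nu> + 4) / 2\<close>.\<close>
  have L': "DN b e a - DN b a e - (\<Sum>c\<in>UNIV. R b c a e * \<mu> c)
    = 2 / \<nu> * ((\<nu> - 2) / 2 * y + v + (t e a - t a e) / 2 - ((\<nu> + 4) / 2 * w + (u a e - u e a) / 2))"
  proof -
    have v: "v = kdelta b e * yg a - kdelta b a * yg e + y - t e a + t a e" using B2 by simp
    have u: "u e a = w + u a e" using B1 by simp
    show ?thesis
      unfolding L R' D\<rho> q_def[symmetric] yg_def[symmetric] v u using \<nu> by (simp add: field_simps)
  qed
  have "x = y \<longleftrightarrow> A = B" if "x - y = k * (A - B)" "k \<noteq> 0" for x y k A B :: real
    using that by auto
  from this[OF L'] show ?thesis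
    unfolding S R2 using \<nu> by simp
qed

section \<open>Connections in a frame\<close>

locale framed_connection =
  fixes A :: "('m::{t2_space, second_countable_topology}, 'n::finite) atlas"
    and nabla :: "'m vfield \<Rightarrow> 'm vfield \<Rightarrow> 'm vfield"
    and U :: "'m set" and X :: "'n \<Rightarrow> 'm vfield" and \<theta> :: "'n \<Rightarrow> 'm form1"
  assumes atlas: "smooth_atlas A"
    and connection: "affine_connection A nabla"
    and torsion: "torsion_free A nabla"
    and frame: "local_frame A U X"
    and coframe: "dual_coframe A U X \<theta>"
begin

abbreviation "\<Gamma> \<equiv> connection_form nabla X \<theta>"

definition G :: "'n \<Rightarrow> 'n \<Rightarrow> 'n \<Rightarrow> 'm \<Rightarrow> real" where
  "G a b c p = \<theta> a p (nabla (X c) (X b) p)"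

text \<open>The structure coefficients of the frame, as \<open>\<theta>_lie_bracket\<close>
  confirms. Defining them through \<open>G\<close> builds torsion-freeness into every later
  formula.\<close>

definition C :: "'n \<Rightarrow> 'n \<Rightarrow> 'n \<Rightarrow> 'm \<Rightarrow> real" where
  "C a b c p = G a c b p - G a b c p"

lemma open_U: "open U"
  and vf_X: "vector_field A U (X a)"
  using frame by (auto simp: local_frame_def)

lemma tangent_X: "p \<in> U \<Longrightarrow> X a p \<in> tangent_space A p"
  using vf_X by (auto simp: vector_field_def)

lemma form_\<theta>: "one_form A U (\<theta> a)"
  and \<theta>_X: "p \<in> U \<Longrightarrow> \<theta> a p (X b p) = kdelta a b"
  using coframe by (auto simp: dual_coframe_def)

lemma cotangent_\<theta>: "p \<in> U \<Longrightarrow> \<theta> a p \<in> cotangent_space A p"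
  using form_\<theta> by (auto simp: one_form_def)

lemma vf_nabla: "vector_field A U Y \<Longrightarrow> vector_field A U Z \<Longrightarrow> vector_field A U (nabla Y Z)"
  using connection open_U unfolding affine_connection_def by blast

lemma smooth_\<theta>: "vector_field A U Y \<Longrightarrow> smooth_fun A U (\<lambda>p. \<theta> a p (Y p))"
  using form_\<theta> open_U by (auto simp: one_form_def)

lemma smooth_G: "smooth_fun A U (G a b c)"
  unfolding G_def[abs_def] by (intro smooth_\<theta> vf_nabla vf_X)

lemma smooth_derivative: "vector_field A U Y \<Longrightarrow> smooth_fun A U f \<Longrightarrow> smooth_fun A U (\<lambda>p. Y p f)"
  using open_U by (auto simp: vector_field_def)

lemma smooth_X: "smooth_fun A U f \<Longrightarrow> smooth_fun A U (\<lambda>p. X a p f)"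
  using smooth_derivative[OF vf_X] .

lemmas smooth_intros = smooth_fun_const smooth_fun_add[OF atlas open_U] smooth_fun_mult[OF atlas open_U]
  smooth_fun_uminus[OF atlas open_U] smooth_fun_diff[OF atlas open_U] smooth_fun_sum[OF atlas open_U]
  smooth_G smooth_X

lemma smooth_C: "smooth_fun A U (C a b c)"
  unfolding C_def[abs_def] by (intro smooth_intros)

lemma near: "smooth_fun A U f \<Longrightarrow> p \<in> U \<Longrightarrow> smooth_near A p f"
  using smooth_fun_imp_near open_U by blast

lemmas near_intros = smooth_near_intros[OF atlas]
lemmas X_simps = tangent_simps[OF atlas tangent_X]

lemma connection_form_eq: "\<Gamma> a b p v = (\<Sum>c\<in>UNIV. G a b c p * \<theta> c p v)"
  by (simp add: connection_form_def G_def)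

lemma connection_form_X: "p \<in> U \<Longrightarrow> \<Gamma> a b p (X c p) = G a b c p"
  by (simp add: connection_form_eq \<theta>_X)

lemma lie_bracket_nabla:
  assumes "vector_field A U Y" "vector_field A U Z" "p \<in> U"
  shows "lie_bracket A Y Z p = (\<lambda>f. nabla Y Z p f - nabla Z Y p f)"
  using torsion open_U assms unfolding torsion_free_def by fastforce

lemma \<theta>_lie_bracket: "p \<in> U \<Longrightarrow> \<theta> a p (lie_bracket A (X b) (X c) p) = C a b c p"
  using vf_nabla[OF vf_X vf_X] unfolding lie_bracket_nabla[OF vf_X vf_X] C_def G_def
  by (subst cotangent_diff[OF cotangent_\<theta>]) (auto simp: vector_field_def)

lemma tangent_lie_bracket:
  assumes "p \<in> U" shows "lie_bracket A (X b) (X c) p \<in> tangent_space A p"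
proof -
  have T: "nabla (X b) (X c) p \<in> tangent_space A p" "nabla (X c) (X b) p \<in> tangent_space A p"
    using vf_nabla[OF vf_X vf_X] assms by (auto simp: vector_field_def)
  show ?thesis
    using tangent_space_diff[OF T] unfolding lie_bracket_nabla[OF vf_X vf_X assms] .
qed

lemma \<theta>_sum:
  assumes "p \<in> U"
  shows "\<theta> a p (\<lambda>f. \<Sum>b\<in>UNIV. c b * X b p f) = c a"
proof -
  have scale: "\<theta> a p (\<lambda>f. k * X b p f) = k * kdelta a b" for k b
    using cotangent_scale[OF cotangent_\<theta>[OF assms] tangent_X[OF assms], of a k b]
    by (simp add: \<theta>_X assms)
  have tangent: "(\<lambda>f. k * X b p f) \<in> tangent_space A p" for k b
    by (rule tangent_space_scale[OF tangent_X[OF assms]])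
  \<comment> \<open>Tangency of the partial sums is carried along because a covector is additive
    only on tangent vectors; the empty sum is a multiple by 0.\<close>
  have "\<theta> a p (\<lambda>f. \<Sum>b\<in>I. c b * X b p f) = (\<Sum>b\<in>I. c b * kdelta a b) \<and>
     (\<lambda>f. \<Sum>b\<in>I. c b * X b p f) \<in> tangent_space A p" if "finite I" for I
    using that
  proof induction
    case empty
    show ?case using scale[of 0] tangent[of 0] by simp
  next
    case (insert b I)
    then show ?case
      using cotangent_add[OF cotangent_\<theta>[OF assms] tangent, of _ a "c b" b]
        tangent_space_add[OF tangent, of _ "c b" b]
      by (simp add: scale)
  qed
  from this[of UNIV] show ?thesis by simp
qed

lemma tangent_expand:
  assumes "p \<in> U" "v \<in> tangent_space A p"
  shows "v f = (\<Sum>a\<in>UNIV. \<theta> a p v * X a p f)"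
proof -
  obtain c where c: "v = (\<lambda>f. \<Sum>a\<in>UNIV. c a * X a p f)"
    using frame assms unfolding local_frame_def by blast
  show ?thesis by (simp add: c \<theta>_sum[OF assms(1)])
qed

text \<open>Smoothness near \<open>p\<close> selects the branch of \<open>lie_bracket\<close> in
  which it is the commutator.\<close>

lemma bracket:
  assumes "p \<in> U" "smooth_near A p f"
  shows "X b p (\<lambda>q. X c q f) - X c p (\<lambda>q. X b q f) = (\<Sum>a\<in>UNIV. C a b c p * X a p f)"
  using tangent_expand[OF assms(1) tangent_lie_bracket[OF assms(1)], of b c f] assms
  by (simp add: \<theta>_lie_bracket) (simp add: lie_bracket_def)

text \<open>Applied to a test function, the threefold derivatives cancel in the cyclic sum of double
  brackets; the coefficients then vanish because \<open>\<theta>_sum\<close> recovers them from the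
  tangent vector.\<close>

lemma jacobi:
  assumes p: "p \<in> U"
  shows "X b p (C a c d) + X c p (C a d b) + X d p (C a b c)
      + (\<Sum>e\<in>UNIV. C e c d p * C a b e p + C e d b p * C a c e p + C e b c p * C a d e p) = 0"
proof -
  \<comment> \<open>\<open>J b c d a\<close> is the \<open>a\<close>-component of the double bracket of \<open>X b\<close> with \<open>[X c, X d]\<close>.\<close>
  define J where "J b c d a = X b p (C a c d) + (\<Sum>e\<in>UNIV. C e c d p * C a b e p)" for a b c d
  have step: "(\<Sum>a\<in>UNIV. J b c d a * X a p f)
     = X b p (\<lambda>q. X c q (\<lambda>r. X d r f)) - X b p (\<lambda>q. X d q (\<lambda>r. X c r f))
       - (X c p (\<lambda>q. X d q (\<lambda>r. X b r f)) - X d p (\<lambda>q. X c q (\<lambda>r. X b r f)))"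
    if f: "smooth_near A p f" for b c d f
  proof -
    \<comment> \<open>A common neighbourhood inside \<open>U\<close> on which \<open>f\<close> and
      its iterated frame derivatives stay smooth, so that \<open>bracket\<close> can be used at
      nearby points and then differentiated.\<close>
    obtain V where V: "open V" "p \<in> V" "V \<subseteq> U" "smooth_fun A V f"
    proof -
      obtain W where "open W" "p \<in> W" "smooth_fun A W f"
        using f by (auto simp: smooth_near_def)
      then show ?thesis using that[of "W \<inter> U"] p open_U by (auto intro: smooth_fun_subset)
    qed
    have sm: "smooth_fun A V (\<lambda>q. X a q h)" if "smooth_fun A V h" for a h
      using vf_X V that by (auto simp: vector_field_def)
    have ne: "smooth_near A q h" if "smooth_fun A V h" "q \<in> V" for q h
      using smooth_fun_imp_near V that by blast
    have "X b p (\<lambda>q. X c q (\<lambda>r. X d r f)) - X b p (\<lambda>q. X d q (\<lambda>r. X c r f))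
        = X b p (\<lambda>q. X c q (\<lambda>r. X d r f) - X d q (\<lambda>r. X c r f))"
      using p V by (intro X_simps(5)[symmetric] ne sm) auto
    also have "\<dots> = X b p (\<lambda>q. \<Sum>a\<in>UNIV. C a c d q * X a q f)"
      using V by (intro tangent_cong[OF atlas tangent_X[OF p] V(1,2)] bracket ne) auto
    also have "\<dots> = (\<Sum>a\<in>UNIV. X b p (C a c d) * X a p f + C a c d p * X b p (\<lambda>q. X a q f))"
      using p V ne[OF sm] near[OF smooth_C p]
      by (simp add: X_simps near_intros)
    finally have 1: "X b p (\<lambda>q. X c q (\<lambda>r. X d r f)) - X b p (\<lambda>q. X d q (\<lambda>r. X c r f)) = \<dots>" .
    have 2: "X c p (\<lambda>q. X d q (\<lambda>r. X b r f)) - X d p (\<lambda>q. X c q (\<lambda>r. X b r f))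
        = (\<Sum>a\<in>UNIV. C a c d p * X a p (\<lambda>q. X b q f))"
      using p V by (intro bracket ne sm) auto
    have "1": "X b p (\<lambda>q. X c q (\<lambda>r. X d r f)) - X b p (\<lambda>q. X d q (\<lambda>r. X c r f))
       - (X c p (\<lambda>q. X d q (\<lambda>r. X b r f)) - X d p (\<lambda>q. X c q (\<lambda>r. X b r f)))
       = (\<Sum>a\<in>UNIV. X b p (C a c d) * X a p f + C a c d p * (X b p (\<lambda>q. X a q f) - X a p (\<lambda>q. X b q f)))"
      unfolding 1 2 by (simp add: sum_subtractf[symmetric] algebra_simps)
    also have "\<dots> = (\<Sum>a\<in>UNIV. X b p (C a c d) * X a p f) + (\<Sum>e\<in>UNIV. \<Sum>a\<in>UNIV. C e c d p * C a b e p * X a p f)"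
      unfolding bracket[OF p f] by (simp add: sum.distrib sum_distrib_left mult.assoc)
    also have "\<dots> = (\<Sum>a\<in>UNIV. J b c d a * X a p f)"
      unfolding J_def by (subst sum.swap) (simp add: sum.distrib sum_distrib_right distrib_right)
    finally show ?thesis by simp
  qed
  \<comment> \<open>To apply \<open>\<theta>_sum\<close> the vector must vanish as a function on all
    test functions; on those not smooth near \<open>p\<close> the default value 0 does it.\<close>
  have zero: "(\<Sum>a\<in>UNIV. (J b c d a + J c d b a + J d b c a) * X a p f) = 0" for f
  proof (cases "smooth_near A p f")
    case True
    have "(\<Sum>a\<in>UNIV. (J b c d a + J c d b a + J d b c a) * X a p f)
      = (\<Sum>a\<in>UNIV. J b c d a * X a p f) + (\<Sum>a\<in>UNIV. J c d b a * X a p f) + (\<Sum>a\<in>UNIV. J d b c a * X a p f)"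
      by (simp add: sum.distrib distrib_right)
    then show ?thesis unfolding step[OF True] by simp
  next
    case False
    then have "X a p f = 0" for a using tangent_X[OF p] by (auto simp: tangent_space_def)
    then show ?thesis by simp
  qed
  have "J b c d a + J c d b a + J d b c a = 0"
    using \<theta>_sum[OF p, of a "\<lambda>a. J b c d a + J c d b a + J d b c a"]
      \<theta>_sum[OF p, of a "\<lambda>a. 0"] by (simp add: zero)
  then show ?thesis
    unfolding J_def by (simp add: sum.distrib algebra_simps)
qed

end

section \<open>Covariant differentials and curvature in frame components\<close>

lemma D_vector_eq: "D_vector \<Gamma> \<mu> b p v = v (\<mu> b) + (\<Sum>a\<in>UNIV. \<Gamma> b a p v * \<mu> a p)"
  by (simp add: D_vector_def cov_diff0_def)

lemma D2_vector_eq: "D2_vector A \<Gamma> \<mu> b Y Z p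
    = ext_deriv A (D_vector \<Gamma> \<mu> b) Y Z p + (\<Sum>a\<in>UNIV. wedge (\<Gamma> b a) (D_vector \<Gamma> \<mu> a) Y Z p)"
  by (simp add: D2_vector_def cov_diff1_def)

lemma D_bivector_eq: "D_bivector \<Gamma> g b c p v = v (g b c)
    + (\<Sum>a\<in>UNIV. \<Gamma> b a p v * g a c p) + (\<Sum>a\<in>UNIV. \<Gamma> c a p v * g b a p)"
  by (simp add: D_bivector_def cov_diff0_def lessThan_Suc numeral_2_eq_2)

lemma D_function_eq: "D_function \<Gamma> \<rho> p v = v \<rho>"
  by (simp add: D_function_def cov_diff0_def)

context framed_connection
begin

abbreviation "R \<equiv> riem A X \<Gamma>"
abbreviation "P \<equiv> schouten A X \<Gamma>"
abbreviation "W \<equiv> weyl A X \<Gamma>"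

lemma riem_eq:
  assumes p: "p \<in> U"
  shows "R a b c d p = X c p (G a b d) - X d p (G a b c) - (\<Sum>e\<in>UNIV. C e c d p * G a b e p)
    + (\<Sum>e\<in>UNIV. G a e c p * G e b d p - G a e d p * G e b c p)"
proof -
  have "X c p (\<lambda>q. \<Gamma> a b q (X d q)) = X c p (G a b d)" for c d
    by (rule tangent_cong[OF atlas tangent_X[OF p] open_U p]) (simp add: connection_form_X)
  moreover have "\<Gamma> a b p (lie_bracket A (X c) (X d) p) = (\<Sum>e\<in>UNIV. C e c d p * G a b e p)"
    by (simp add: connection_form_eq \<theta>_lie_bracket p mult.commute)
  ultimately show ?thesis
    by (simp add: riem_def curv_form_def ext_deriv_def wedge_def connection_form_X p)
qed

lemma smooth_riem: "smooth_fun A U (R a b c d)"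
  by (rule smooth_fun_cong[OF atlas open_U riem_eq[symmetric]])
     (intro smooth_intros smooth_C | assumption)+

lemma smooth_schouten: "smooth_fun A U (P a b)"
  unfolding schouten_def[abs_def] ricci_def sym2_def alt2_def divide_inverse
  by (intro smooth_intros smooth_riem)

text \<open>The covariant derivative of the curvature, direction \<open>e\<close>, already expanded
  in the shape that \<open>bianchi2_algebra\<close> expects.\<close>

definition riem_deriv :: "'n \<Rightarrow> 'n \<Rightarrow> 'n \<Rightarrow> 'n \<Rightarrow> 'n \<Rightarrow> 'm \<Rightarrow> real" where
  "riem_deriv a b c d e p = X e p (R a b c d) + (\<Sum>f\<in>UNIV. G a f e p * R f b c d p)
      - (\<Sum>f\<in>UNIV. G f b e p * R a f c d p) - (\<Sum>f\<in>UNIV. G f c e p * R a b f d p)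
      - (\<Sum>f\<in>UNIV. G f d e p * R a b c f p)"

lemma schouten_deriv_eq:
  assumes "p \<in> U"
  shows "schouten_deriv A X \<Gamma> a b e p = X e p (P a b) - (\<Sum>f\<in>UNIV. G f a e p * P f b p)
    - (\<Sum>f\<in>UNIV. G f b e p * P a f p)"
  using assms
  by (simp add: schouten_deriv_def cov_diff0_def lessThan_Suc numeral_2_eq_2 connection_form_X)

lemma weyl_deriv_eq:
  assumes "p \<in> U"
  shows "weyl_deriv A X \<Gamma> a b c d e p = X e p (W a b c d) + (\<Sum>f\<in>UNIV. G a f e p * W f b c d p)
    - (\<Sum>f\<in>UNIV. G f b e p * W a f c d p) - (\<Sum>f\<in>UNIV. G f c e p * W a b f d p)
    - (\<Sum>f\<in>UNIV. G f d e p * W a b c f p)"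
  using assms
  by (simp add: weyl_deriv_def cov_diff0_def lessThan_Suc numeral_3_eq_3 numeral_2_eq_2 connection_form_X)

lemma X_C: "p \<in> U \<Longrightarrow> X e p (C f c d) = X e p (G f d c) - X e p (G f c d)"
  unfolding C_def[abs_def] by (simp add: X_simps near smooth_G)

lemma riem_bianchi1:
  assumes p: "p \<in> U"
  shows "R a b c d p + R a c d b p + R a d b c p = 0"
  by (rule bianchi1_algebra[OF C_def X_C[OF p] jacobi[OF p] riem_eq[OF p]])

lemma riem_bianchi2:
  assumes p: "p \<in> U"
  shows "riem_deriv a b c d e p + riem_deriv a b d e c p + riem_deriv a b e c d p = 0"
proof (rule bianchi2_algebra[OF C_def X_C[OF p] bracket[OF p near[OF smooth_G p]] jacobi[OF p]
      riem_eq[OF p] _ riem_deriv_def])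
  fix e a b c d
  have "X e p (R a b c d) = X e p (\<lambda>p. X c p (G a b d) - X d p (G a b c) - (\<Sum>e\<in>UNIV. C e c d p * G a b e p)
    + (\<Sum>e\<in>UNIV. G a e c p * G e b d p - G a e d p * G e b c p))"
    by (rule tangent_cong[OF atlas tangent_X[OF p] open_U p riem_eq])
  also have "\<dots> = X e p (\<lambda>p. X c p (G a b d)) - X e p (\<lambda>p. X d p (G a b c))
    - (\<Sum>f\<in>UNIV. X e p (C f c d) * G a b f p + C f c d p * X e p (G a b f))
    + (\<Sum>f\<in>UNIV. X e p (G a f c) * G f b d p + G a f c p * X e p (G f b d)
       - (X e p (G a f d) * G f b c p + G a f d p * X e p (G f b c)))"
    using p by (simp add: X_simps near_intros near smooth_G smooth_C smooth_X)
  finally show "X e p (R a b c d) = \<dots>" .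
qed

lemma riem_skew: "R a b c d p = - R a b d c p" if "p \<in> U"
proof -
  have "(\<Sum>e\<in>UNIV. C e c d p * G a b e p) = - (\<Sum>e\<in>UNIV. C e d c p * G a b e p)"
    unfolding C_def sum_negf[symmetric] by (rule sum.cong) (simp_all add: algebra_simps)
  then show ?thesis by (simp add: riem_eq that sum_subtractf)
qed

lemma riem_deriv_skew:
  assumes p: "p \<in> U"
  shows "riem_deriv a b c d e p = - riem_deriv a b d c e p"
proof -
  have "X e p (R a b c d) = X e p (\<lambda>q. - R a b d c q)"
    by (rule tangent_cong[OF atlas tangent_X[OF p] open_U p riem_skew])
  also have "\<dots> = - X e p (R a b d c)"
    using p by (simp add: X_simps near smooth_riem)
  finally have D: "X e p (R a b c d) = - X e p (R a b d c)" .
  have "(\<Sum>f\<in>UNIV. h f * R f b c d p) = - (\<Sum>f\<in>UNIV. h f * R f b d c p)"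
    "(\<Sum>f\<in>UNIV. h f * R a f c d p) = - (\<Sum>f\<in>UNIV. h f * R a f d c p)"
    "(\<Sum>f\<in>UNIV. h f * R a b f d p) = - (\<Sum>f\<in>UNIV. h f * R a b d f p)"
    "(\<Sum>f\<in>UNIV. h f * R a b c f p) = - (\<Sum>f\<in>UNIV. h f * R a b f c p)" for h :: "'n \<Rightarrow> real"
    by (subst riem_skew[OF p], simp add: sum_negf)+
  with D show ?thesis
    unfolding riem_deriv_def by simp
qed

text \<open>Products of \<open>\<Gamma>\<close> with derivatives of \<open>\<mu>\<close> arise
  twice, from the exterior derivative of the connection term and from the wedge with
  \<open>D_vector\<close>, with opposite signs. The bracket absorbs the second derivatives of
  \<open>\<mu>\<close>, and the terms left over assemble the curvature.\<close>

lemma ricci_identity: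
  assumes \<mu>: "\<And>a. smooth_fun A U (\<mu> a)" and Y: "vector_field A U Y" and Z: "vector_field A U Z"
    and p: "p \<in> U"
  shows "D2_vector A \<Gamma> \<mu> b Y Z p = (\<Sum>a\<in>UNIV. curv_form A \<Gamma> b a Y Z p * \<mu> a p)"
proof -
  have deriv: "Y p (\<lambda>q. D_vector \<Gamma> \<mu> b q (Z q)) = Y p (\<lambda>q. Z q (\<mu> b))
      + (\<Sum>a\<in>UNIV. Y p (\<lambda>q. \<Gamma> b a q (Z q)) * \<mu> a p + \<Gamma> b a p (Z p) * Y p (\<mu> a))"
    if Y: "vector_field A U Y" and Z: "vector_field A U Z" for Y Z
  proof -
    have "smooth_fun A U (\<lambda>q. \<Gamma> b a q (Z q))" for a
      unfolding connection_form_eq by (intro smooth_intros smooth_\<theta> Z)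
    moreover have Yp: "Y p \<in> tangent_space A p" using Y p by (auto simp: vector_field_def)
    ultimately show ?thesis
      unfolding D_vector_eq
      using p smooth_derivative[OF Z \<mu>]
      by (simp add: tangent_simps[OF atlas Yp] near_intros near \<mu>)
  qed
  have bracket: "lie_bracket A Y Z p (\<mu> b) = Y p (\<lambda>q. Z q (\<mu> b)) - Z p (\<lambda>q. Y q (\<mu> b))"
    using near[OF \<mu> p] by (simp add: lie_bracket_def)
  have \<Gamma>\<Gamma>: "(\<Sum>a\<in>UNIV. \<Gamma> b a p (Y p) * (\<Sum>c\<in>UNIV. \<Gamma> a c p (Z p) * \<mu> c p))
      = (\<Sum>a\<in>UNIV. (\<Sum>c\<in>UNIV. \<Gamma> b c p (Y p) * \<Gamma> c a p (Z p)) * \<mu> a p)" for Y Z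
    unfolding sum_distrib_left sum_distrib_right by (subst sum.swap) (simp add: mult.assoc)
  have wedge: "(\<Sum>a\<in>UNIV. wedge (\<Gamma> b a) (D_vector \<Gamma> \<mu> a) Y Z p)
     = (\<Sum>a\<in>UNIV. \<Gamma> b a p (Y p) * Z p (\<mu> a)) - (\<Sum>a\<in>UNIV. \<Gamma> b a p (Z p) * Y p (\<mu> a))
     + (\<Sum>a\<in>UNIV. (\<Sum>c\<in>UNIV. wedge (\<Gamma> b c) (\<Gamma> c a) Y Z p) * \<mu> a p)"
  proof -
    have "(\<Sum>a\<in>UNIV. wedge (\<Gamma> b a) (D_vector \<Gamma> \<mu> a) Y Z p)
     = (\<Sum>a\<in>UNIV. \<Gamma> b a p (Y p) * Z p (\<mu> a)) - (\<Sum>a\<in>UNIV. \<Gamma> b a p (Z p) * Y p (\<mu> a))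
     + ((\<Sum>a\<in>UNIV. \<Gamma> b a p (Y p) * (\<Sum>c\<in>UNIV. \<Gamma> a c p (Z p) * \<mu> c p))
      - (\<Sum>a\<in>UNIV. \<Gamma> b a p (Z p) * (\<Sum>c\<in>UNIV. \<Gamma> a c p (Y p) * \<mu> c p)))"
      by (simp add: wedge_def D_vector_eq distrib_left sum.distrib sum_subtractf)
    then show ?thesis unfolding \<Gamma>\<Gamma> wedge_def by (simp add: sum_subtractf algebra_simps)
  qed
  have ext: "ext_deriv A (D_vector \<Gamma> \<mu> b) Y Z p
     = (\<Sum>a\<in>UNIV. ext_deriv A (\<Gamma> b a) Y Z p * \<mu> a p)
      - ((\<Sum>a\<in>UNIV. \<Gamma> b a p (Y p) * Z p (\<mu> a)) - (\<Sum>a\<in>UNIV. \<Gamma> b a p (Z p) * Y p (\<mu> a)))"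
    unfolding ext_deriv_def deriv[OF Y Z] deriv[OF Z Y] D_vector_eq[of \<Gamma> \<mu> b p "lie_bracket A Y Z p"] bracket
    by (simp add: left_diff_distrib sum.distrib sum_subtractf)
  show ?thesis
    unfolding D2_vector_eq ext wedge curv_form_def by (simp add: distrib_right sum.distrib)
qed

text \<open>Torsion-freeness, through \<open>C\<close>, makes the bracket term of
  \<open>ext_deriv\<close> supply the connection terms of the lower index. Hence this is a skew
  second covariant derivative, as \<open>integrability_algebra\<close> needs.\<close>

lemma D2_vector_frame:
  fixes \<mu> :: "'n \<Rightarrow> 'm \<Rightarrow> real"
  assumes p: "p \<in> U"
  defines "N \<equiv> \<lambda>b e q. D_vector \<Gamma> \<mu> b q (X e q)"
  shows "D2_vector A \<Gamma> \<mu> b (X a) (X e) p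
    = (X a p (N b e) + (\<Sum>f\<in>UNIV. G b f a p * N f e p) - (\<Sum>f\<in>UNIV. G f e a p * N b f p))
    - (X e p (N b a) + (\<Sum>f\<in>UNIV. G b f e p * N f a p) - (\<Sum>f\<in>UNIV. G f a e p * N b f p))"
proof -
  have "D_vector \<Gamma> \<mu> b p v = (\<Sum>f\<in>UNIV. \<theta> f p v * N b f p)" if v: "v \<in> tangent_space A p" for v
  proof -
    have "(\<Sum>c\<in>UNIV. \<Gamma> b c p v * \<mu> c p) = (\<Sum>f\<in>UNIV. \<theta> f p v * (\<Sum>c\<in>UNIV. G b c f p * \<mu> c p))"
      unfolding connection_form_eq sum_distrib_left sum_distrib_right
      by (subst sum.swap) (simp add: ac_simps)
    then show ?thesis
      unfolding N_def D_vector_eq tangent_expand[OF p v, of "\<mu> b"] connection_form_X[OF p]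
      by (simp add: distrib_left sum.distrib)
  qed
  from this[OF tangent_lie_bracket[OF p]]
  have "D_vector \<Gamma> \<mu> b p (lie_bracket A (X a) (X e) p)
      = (\<Sum>f\<in>UNIV. G f e a p * N b f p) - (\<Sum>f\<in>UNIV. G f a e p * N b f p)"
    by (simp add: \<theta>_lie_bracket p C_def left_diff_distrib sum_subtractf)
  then show ?thesis
    unfolding D2_vector_eq ext_deriv_def wedge_def N_def connection_form_X[OF p]
    by (simp add: sum_subtractf mult.commute)
qed

end

section \<open>Weyl and Cotton tensors for a symmetric Schouten tensor\<close>

locale symmetric_schouten_connection = framed_connection A nabla U X \<theta>
  for A :: "('m::{t2_space, second_countable_topology}, 'n::finite) atlas"
    and nabla U and X :: "'n \<Rightarrow> 'm vfield" and \<theta> +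
  assumes schouten_sym: "p \<in> U \<Longrightarrow> P a b p = P b a p"
begin

lemma weyl_eq: "p \<in> U \<Longrightarrow> W a b c d p = R a b c d p - kdelta a c * P d b p + kdelta a d * P c b p"
  using schouten_sym[of p c d] by (simp add: weyl_def alt2_def)

lemma smooth_weyl: "smooth_fun A U (W a b c d)"
  by (rule smooth_fun_cong[OF atlas open_U weyl_eq[symmetric]])
     (intro smooth_intros smooth_riem smooth_schouten | assumption)+

lemma weyl_skew: "p \<in> U \<Longrightarrow> W a b c d p = - W a b d c p"
  using riem_skew[of p a b c d] by (simp add: weyl_eq)

text \<open>The six Schouten terms of the cyclic sum cancel in pairs by symmetry.\<close>

lemma weyl_bianchi1:
  assumes p: "p \<in> U"
  shows "W a b c d p + W a c d b p + W a d b c p = 0"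
  using riem_bianchi1[OF p, of a b c d] schouten_sym[OF p] by (simp add: weyl_eq[OF p])

text \<open>The identity tensor is parallel: the products \<open>G a c e p * P d b p\<close> and
  \<open>G a d e p * P c b p\<close> from the upper index in \<open>1\<close> cancel those from the
  lower indices in \<open>3\<close> and \<open>4\<close>.\<close>

lemma weyl_deriv_riem:
  assumes p: "p \<in> U"
  shows "weyl_deriv A X \<Gamma> a b c d e p = riem_deriv a b c d e p
    - kdelta a c * schouten_deriv A X \<Gamma> d b e p + kdelta a d * schouten_deriv A X \<Gamma> c b e p"
proof -
  have "X e p (W a b c d) = X e p (\<lambda>q. R a b c d q - kdelta a c * P d b q + kdelta a d * P c b q)"
    by (rule tangent_cong[OF atlas tangent_X[OF p] open_U p weyl_eq])
  then have D: "X e p (W a b c d) = X e p (R a b c d) - kdelta a c * X e p (P d b) + kdelta a d * X e p (P c b)"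
    using p by (simp add: X_simps near_intros near smooth_riem smooth_schouten)
  have 1: "(\<Sum>f\<in>UNIV. G a f e p * W f b c d p) = (\<Sum>f\<in>UNIV. G a f e p * R f b c d p)
      - G a c e p * P d b p + G a d e p * P c b p"
    unfolding weyl_eq[OF p]
    by (simp add: distrib_left right_diff_distrib sum.distrib sum_subtractf mult.assoc[symmetric]
        sum_distrib_right[symmetric])
  have 2: "(\<Sum>f\<in>UNIV. G f b e p * W a f c d p) = (\<Sum>f\<in>UNIV. G f b e p * R a f c d p)
      - kdelta a c * (\<Sum>f\<in>UNIV. G f b e p * P d f p) + kdelta a d * (\<Sum>f\<in>UNIV. G f b e p * P c f p)"
    unfolding weyl_eq[OF p]
    by (simp add: distrib_left right_diff_distrib sum.distrib sum_subtractf mult.left_commute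
        sum_distrib_left)
  have 3: "(\<Sum>f\<in>UNIV. G f c e p * W a b f d p) = (\<Sum>f\<in>UNIV. G f c e p * R a b f d p)
      - G a c e p * P d b p + kdelta a d * (\<Sum>f\<in>UNIV. G f c e p * P f b p)"
    unfolding weyl_eq[OF p]
    by (simp add: distrib_left right_diff_distrib sum.distrib sum_subtractf mult.left_commute
        sum_distrib_left)
  have 4: "(\<Sum>f\<in>UNIV. G f d e p * W a b c f p) = (\<Sum>f\<in>UNIV. G f d e p * R a b c f p)
      - kdelta a c * (\<Sum>f\<in>UNIV. G f d e p * P f b p) + G a d e p * P c b p"
    unfolding weyl_eq[OF p]
    by (simp add: distrib_left right_diff_distrib sum.distrib sum_subtractf mult.left_commute
        sum_distrib_left)
  show ?thesis
    unfolding weyl_deriv_eq[OF p] riem_deriv_def schouten_deriv_eq[OF p] D 1 2 3 4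
    by (simp add: algebra_simps)
qed

lemma weyl_deriv_skew:
  assumes p: "p \<in> U"
  shows "weyl_deriv A X \<Gamma> a b c d e p = - weyl_deriv A X \<Gamma> a b d c e p"
  using riem_deriv_skew[OF p, of a b c d e] by (simp add: weyl_deriv_riem[OF p])

lemma cotton_eq: "cotton A X \<Gamma> b c a p = schouten_deriv A X \<Gamma> c a b p - schouten_deriv A X \<Gamma> b a c p"
  by (simp add: cotton_def alt2_def)

text \<open>The curvature part vanishes cyclically; at each \<open>kdelta\<close> two Schouten
  derivatives remain, whose difference is a Cotton component.\<close>

lemma weyl_bianchi2:
  assumes p: "p \<in> U"
  shows "weyl_deriv A X \<Gamma> b d e a c p + weyl_deriv A X \<Gamma> b d a c e p + weyl_deriv A X \<Gamma> b d c e a p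
    = - (kdelta b a * cotton A X \<Gamma> e c d p + kdelta b c * cotton A X \<Gamma> a e d p
        + kdelta b e * cotton A X \<Gamma> c a d p)"
  using riem_bianchi2[OF p, of b d e a c]
  unfolding weyl_deriv_riem[OF p] cotton_eq by (simp add: algebra_simps)

lemma integrability:
  assumes \<mu>: "\<And>a. smooth_fun A U (\<mu> a)" and g: "\<And>a b. smooth_fun A U (g a b)"
    and \<rho>: "smooth_fun A U \<rho>"
    and g_sym: "\<And>p a b. p \<in> U \<Longrightarrow> g a b p = g b a p"
    and Dg: "\<And>p a b c. p \<in> U \<Longrightarrow> D_bivector \<Gamma> g b c p (X a p) = \<mu> c p * kdelta b a + \<mu> b p * kdelta c a"
    and D\<mu>: "\<And>p b e. p \<in> U \<Longrightarrow> D_vector \<Gamma> \<mu> b p (X e p) = \<rho> p * kdelta b e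
          - (\<Sum>c\<in>UNIV. P e c p * g b c p)
          - 1 / real CARD('n) * (\<Sum>c\<in>UNIV. \<Sum>d\<in>UNIV. W b c d e p * g c d p)"
    and D\<rho>: "\<And>p a. p \<in> U \<Longrightarrow> D_function \<Gamma> \<rho> p (X a p) = - 2 * (\<Sum>c\<in>UNIV. P a c p * \<mu> c p)
          + 2 / real CARD('n) * (\<Sum>c\<in>UNIV. \<Sum>d\<in>UNIV. cotton A X \<Gamma> a c d p * g c d p)"
    and p: "p \<in> U"
  shows "D2_vector A \<Gamma> \<mu> b (X a) (X e) p = (\<Sum>c\<in>UNIV. R b c a e p * \<mu> c p) \<longleftrightarrow>
    (\<Sum>c\<in>UNIV. \<Sum>d\<in>UNIV. S_tensor A X \<Gamma> a e b c d p * g c d p) =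
            (\<Sum>c\<in>UNIV. ((real CARD('n) + 4) / 2 * W b c a e p
                          + alt2 (\<lambda>a e. W b a e c p) a e) * \<mu> c p)"
proof -
  define \<nu> where "\<nu> = real CARD('n)"
  define N where "N b e q = D_vector \<Gamma> \<mu> b q (X e q)" for b e q
  have Neq: "N b e q = \<rho> q * kdelta b e - (\<Sum>c\<in>UNIV. P e c q * g b c q)
          - 1 / \<nu> * (\<Sum>c\<in>UNIV. \<Sum>d\<in>UNIV. W b c d e q * g c d q)" if "q \<in> U" for b e q
    using D\<mu>[OF that] by (simp add: N_def \<nu>_def)
  have Dg': "X a p (g b c) + (\<Sum>f\<in>UNIV. G b f a p * g f c p) + (\<Sum>f\<in>UNIV. G c f a p * g b f p)
      = \<mu> c p * kdelta b a + \<mu> b p * kdelta c a" for a b c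
    using Dg[OF p] by (simp add: D_bivector_eq connection_form_X[OF p])
  \<comment> \<open>Naming the factor lets it be pulled out of the nested sums as an atom; it is
    unfolded again at the end.\<close>
  define \<kappa> where "\<kappa> = 1 / \<nu>"
  have DN: "X a p (N b e) + (\<Sum>f\<in>UNIV. G b f a p * N f e p) - (\<Sum>f\<in>UNIV. G f e a p * N b f p)
     = X a p \<rho> * kdelta b e
      - (\<Sum>c\<in>UNIV. schouten_deriv A X \<Gamma> e c a p * g b c p
           + P e c p * (\<mu> c p * kdelta b a + \<mu> b p * kdelta c a))
      - \<kappa> * (\<Sum>c\<in>UNIV. \<Sum>d\<in>UNIV. weyl_deriv A X \<Gamma> b c d e a p * g c d p
           + W b c d e p * (\<mu> d p * kdelta c a + \<mu> c p * kdelta d a))" for b e a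
  proof -
    have "X a p (N b e) = X a p (\<lambda>q. \<rho> q * kdelta b e - (\<Sum>c\<in>UNIV. P e c q * g b c q)
          - \<kappa> * (\<Sum>c\<in>UNIV. \<Sum>d\<in>UNIV. W b c d e q * g c d q))"
      by (rule tangent_cong[OF atlas tangent_X[OF p] open_U p Neq[folded \<kappa>_def]])
    also have "\<dots> = X a p \<rho> * kdelta b e
        - (\<Sum>c\<in>UNIV. X a p (P e c) * g b c p + P e c p * X a p (g b c))
        - \<kappa> * (\<Sum>c\<in>UNIV. \<Sum>d\<in>UNIV. X a p (W b c d e) * g c d p + W b c d e p * X a p (g c d))"
      using p by (simp add: X_simps near_intros near smooth_weyl smooth_schouten \<rho> g)
    finally have 1: "X a p (N b e) = \<dots>" .
    \<comment> \<open>The \<open>\<rho> p * G b e a p\<close> here and in \<open>3\<close> cancel,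
      so only the derivative of \<open>\<rho>\<close> survives; the other sums are regrouped by the
      contraction lemmas in \<open>4\<close> and \<open>5\<close>.\<close>
    have 2: "(\<Sum>f\<in>UNIV. G b f a p * N f e p) = \<rho> p * G b e a p
       - (\<Sum>f\<in>UNIV. G b f a p * (\<Sum>c\<in>UNIV. P e c p * g f c p))
       - \<kappa> * (\<Sum>f\<in>UNIV. G b f a p * (\<Sum>c\<in>UNIV. \<Sum>d\<in>UNIV. W f c d e p * g c d p))"
      unfolding Neq[OF p, folded \<kappa>_def] right_diff_distrib sum_subtractf mult.left_commute[of _ \<kappa>]
        sum_distrib_left[symmetric] mult.left_commute[of _ "\<rho> p"] by simp
    have 3: "(\<Sum>f\<in>UNIV. G f e a p * N b f p) = \<rho> p * G b e a p
       - (\<Sum>f\<in>UNIV. G f e a p * (\<Sum>c\<in>UNIV. P f c p * g b c p))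
       - \<kappa> * (\<Sum>f\<in>UNIV. G f e a p * (\<Sum>c\<in>UNIV. \<Sum>d\<in>UNIV. W b c d f p * g c d p))"
      unfolding Neq[OF p, folded \<kappa>_def] right_diff_distrib sum_subtractf mult.left_commute[of _ \<kappa>]
        sum_distrib_left[symmetric] mult.left_commute[of _ "\<rho> p"] by simp
    note 4 = covariant_contraction_2[of "\<lambda>e c. X a p (P e c)" e "\<lambda>b c. g b c p" b "\<lambda>e c. P e c p"
        "\<lambda>b c. X a p (g b c)" "\<lambda>b f. G b f a p"]
    note 5 = covariant_contraction_4[of "\<lambda>b c d e. X a p (W b c d e)" b e "\<lambda>b c. g b c p" "\<lambda>b c d e. W b c d e p"
        "\<lambda>b c. X a p (g b c)" "\<lambda>b f. G b f a p"]
    show ?thesis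
      unfolding weyl_deriv_eq[OF p] schouten_deriv_eq[OF p] Dg'[symmetric] 1 2 3
        4[symmetric] 5[symmetric] by (simp add: algebra_simps)
  qed
  have "\<nu> \<noteq> 0" by (simp add: \<nu>_def)
  moreover have "R a b c d p = W a b c d p + kdelta a c * P d b p - kdelta a d * P c b p" for a b c d
    by (simp add: weyl_eq[OF p])
  moreover have "X a p \<rho> = - 2 * (\<Sum>c\<in>UNIV. P a c p * \<mu> c p)
          + 2 / \<nu> * (\<Sum>c\<in>UNIV. \<Sum>d\<in>UNIV. cotton A X \<Gamma> a c d p * g c d p)" for a
    using D\<rho>[OF p] by (simp add: D_function_eq \<nu>_def)
  ultimately show ?thesis
    unfolding D2_vector_frame[OF p] N_def[symmetric, abs_def] S_tensor_def \<nu>_def[symmetric]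
    by (rule integrability_algebra[OF _ g_sym[OF p] schouten_sym[OF p] _ cotton_eq weyl_skew[OF p]
        weyl_deriv_skew[OF p] weyl_bianchi1[OF p] weyl_bianchi2[OF p] _ DN[unfolded \<kappa>_def]])
qed

end

theorem proposition2p16:
  fixes A :: "('m::{t2_space, second_countable_topology}, 'n::finite) atlas"
    and nabla :: "'m vfield \<Rightarrow> 'm vfield \<Rightarrow> 'm vfield"
    and U :: "'m set"
    and X :: "'n \<Rightarrow> 'm vfield"
    and \<theta> :: "'n \<Rightarrow> 'm form1"
    and \<Gamma> :: "'n \<Rightarrow> 'n \<Rightarrow> 'm form1"
    and g :: "'m bivector"
    and \<mu> :: "'m vfield"
    and \<rho> :: "'m \<Rightarrow> real"
    and gc :: "'n \<Rightarrow> 'n \<Rightarrow> 'm \<Rightarrow> real"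
    and \<mu>c :: "'n \<Rightarrow> 'm \<Rightarrow> real"
  assumes "CARD('n) \<ge> 2"
    and "smooth_atlas A"
    and "affine_connection A nabla"
    and "torsion_free A nabla"
    and "local_frame A U X"
    and "dual_coframe A U X \<theta>"
    and "\<Gamma> = connection_form nabla X \<theta>"
    and schouten_symmetric: "\<forall>p\<in>U. \<forall>a b. schouten A X \<Gamma> a b p = schouten A X \<Gamma> b a p"
    and "symmetric_bivector A UNIV g"
    and "vector_field A UNIV \<mu>"
    and "smooth_fun A UNIV \<rho>"
    and "gc = bivector_comp \<theta> g"
    and "\<mu>c = vector_comp \<theta> \<mu>"
    and system1: "\<forall>p\<in>U. \<forall>v\<in>tangent_space A p. \<forall>b c.
          D_bivector \<Gamma> gc b c p v = \<mu>c c p * \<theta> b p v + \<mu>c b p * \<theta> c p v"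
    and system2: "\<forall>p\<in>U. \<forall>v\<in>tangent_space A p. \<forall>b.
          D_vector \<Gamma> \<mu>c b p v = \<rho> p * \<theta> b p v
            - (\<Sum>c\<in>UNIV. schouten_form A X \<theta> \<Gamma> c p v * gc b c p)
            - 1 / real CARD('n) *
              (\<Sum>a\<in>UNIV. \<Sum>c\<in>UNIV. \<Sum>d\<in>UNIV. weyl A X \<Gamma> b c d a p * gc c d p * \<theta> a p v)"
    and system3: "\<forall>p\<in>U. \<forall>v\<in>tangent_space A p.
          D_function \<Gamma> \<rho> p v = - 2 * (\<Sum>b\<in>UNIV. schouten_form A X \<theta> \<Gamma> b p v * \<mu>c b p)
            + 2 / real CARD('n) *
              (\<Sum>a\<in>UNIV. \<Sum>b\<in>UNIV. \<Sum>c\<in>UNIV. cotton A X \<Gamma> a b c p * gc b c p * \<theta> a p v)"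
  shows "(\<forall>Y Z. vector_field A U Y \<longrightarrow> vector_field A U Z \<longrightarrow> (\<forall>p\<in>U. \<forall>b.
            D2_vector A \<Gamma> \<mu>c b Y Z p = (\<Sum>a\<in>UNIV. curv_form A \<Gamma> b a Y Z p * \<mu>c a p)))
     \<longleftrightarrow>
         (\<forall>p\<in>U. \<forall>a e b.
            (\<Sum>c\<in>UNIV. \<Sum>d\<in>UNIV. S_tensor A X \<Gamma> a e b c d p * gc c d p) =
            (\<Sum>c\<in>UNIV. ((real CARD('n) + 4) / 2 * weyl A X \<Gamma> b c a e p
                          + alt2 (\<lambda>a e. weyl A X \<Gamma> b a e c p) a e) * \<mu>c c p))"
proof -
  have sym: "schouten A X (connection_form nabla X \<theta>) a b p = schouten A X (connection_form nabla X \<theta>) b a p"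
    if "p \<in> U" for p a b
    using schouten_symmetric that unfolding \<open>\<Gamma> = _\<close> by blast
  interpret symmetric_schouten_connection A nabla U X \<theta>
    by unfold_locales (use assms(2-6) sym in auto)
  have gc: "gc b c = (\<lambda>p. g p (\<theta> b p) (\<theta> c p))" for b c
    unfolding \<open>gc = _\<close> bivector_comp_def ..
  have smooth_gc: "smooth_fun A U (gc b c)" for b c
    unfolding gc using \<open>symmetric_bivector A UNIV g\<close> form_\<theta> open_U
    by (auto simp: symmetric_bivector_def)
  have gc_sym: "gc b c p = gc c b p" if "p \<in> U" for b c p
    unfolding gc using \<open>symmetric_bivector A UNIV g\<close> cotangent_\<theta>[OF that]
    by (auto simp: symmetric_bivector_def)
  have smooth_\<mu>c: "smooth_fun A U (\<mu>c b)" for b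
    unfolding \<open>\<mu>c = _\<close> vector_comp_def
    by (intro smooth_\<theta> vector_field_subset[OF \<open>vector_field A UNIV \<mu>\<close>]) simp
  have smooth_\<rho>: "smooth_fun A U \<rho>"
    using smooth_fun_subset[OF \<open>smooth_fun A UNIV \<rho>\<close>] by simp
  have schouten_form_X: "schouten_form A X \<theta> \<Gamma> c p (X a p) = schouten A X \<Gamma> a c p" if "p \<in> U" for a c p
    by (simp add: schouten_form_def \<theta>_X that)
  have iff: "D2_vector A \<Gamma> \<mu>c b (X a) (X e) p = (\<Sum>c\<in>UNIV. riem A X \<Gamma> b c a e p * \<mu>c c p) \<longleftrightarrow>
      (\<Sum>c\<in>UNIV. \<Sum>d\<in>UNIV. S_tensor A X \<Gamma> a e b c d p * gc c d p) =
      (\<Sum>c\<in>UNIV. ((real CARD('n) + 4) / 2 * weyl A X \<Gamma> b c a e p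
                    + alt2 (\<lambda>a e. weyl A X \<Gamma> b a e c p) a e) * \<mu>c c p)"
    if p: "p \<in> U" for p a e b
  proof (rule integrability[OF smooth_\<mu>c smooth_gc smooth_\<rho> gc_sym _ _ _ p, folded \<open>\<Gamma> = _\<close>])
    fix q a b c e assume q: "q \<in> U"
    show "D_bivector \<Gamma> gc b c q (X a q) = \<mu>c c q * kdelta b a + \<mu>c b q * kdelta c a"
      using system1 q by (simp add: tangent_X \<theta>_X)
    have "(\<Sum>a\<in>UNIV. \<Sum>c\<in>UNIV. \<Sum>d\<in>UNIV. weyl A X \<Gamma> b c d a q * gc c d q * kdelta a e)
        = (\<Sum>c\<in>UNIV. \<Sum>d\<in>UNIV. weyl A X \<Gamma> b c d e q * gc c d q)"
      by (simp flip: sum_distrib_right)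
    then show "D_vector \<Gamma> \<mu>c b q (X e q) = \<rho> q * kdelta b e
          - (\<Sum>c\<in>UNIV. schouten A X \<Gamma> e c q * gc b c q)
          - 1 / real CARD('n) * (\<Sum>c\<in>UNIV. \<Sum>d\<in>UNIV. weyl A X \<Gamma> b c d e q * gc c d q)"
      using system2 q by (simp add: tangent_X \<theta>_X schouten_form_X)
    have "(\<Sum>e\<in>UNIV. \<Sum>c\<in>UNIV. \<Sum>d\<in>UNIV. cotton A X \<Gamma> e c d q * gc c d q * kdelta e a)
        = (\<Sum>c\<in>UNIV. \<Sum>d\<in>UNIV. cotton A X \<Gamma> a c d q * gc c d q)"
      by (simp flip: sum_distrib_right)
    then show "D_function \<Gamma> \<rho> q (X a q) = - 2 * (\<Sum>c\<in>UNIV. schouten A X \<Gamma> a c q * \<mu>c c q)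
          + 2 / real CARD('n) * (\<Sum>c\<in>UNIV. \<Sum>d\<in>UNIV. cotton A X \<Gamma> a c d q * gc c d q)"
      using system3 q by (simp add: tangent_X \<theta>_X schouten_form_X)
  qed
  have D2: "D2_vector A \<Gamma> \<mu>c b Y Z p = (\<Sum>a\<in>UNIV. curv_form A \<Gamma> b a Y Z p * \<mu>c a p)"
    if "vector_field A U Y" "vector_field A U Z" "p \<in> U" for Y Z p b
    unfolding \<open>\<Gamma> = _\<close> using ricci_identity[OF smooth_\<mu>c that] .
  show ?thesis
    \<comment> \<open>On a pair of frame fields the curvature form is \<open>riem\<close> by
      definition, so the instance of \<open>D2\<close> there is the left side of
      \<open>iff\<close>.\<close>
    using iff D2 D2[OF vf_X vf_X] unfolding riem_def by blast
qed

end
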